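(* Let $\alpha=(\alpha_i)_{i\in\mathbb{N}}$ be a bounded sequence of strictly positive real numbers, and let $\beta:=\exp(\alpha)=(\exp(\alpha_i))_{i\in\mathbb{N}}$. Let $W_\alpha$ and $W_\beta$ be the associated unilateral weighted shifts. Then $$r(W_\alpha)\leq \log\big(r(W_\beta)\big)= \ell(W_\alpha),$$ where $r$ denotes the spectral radius and $\ell$ the mean limit.
   Context: Here $\mathbb{N}=\{0,1,2,\dots\}$ and $\ell^2(\mathbb{N})$ is the Hilbert space of complex square-summable sequences. For a bounded sequence $\alpha=(\alpha_i)_{i\in\mathbb{N}}$ of strictly positive numbers, the unilateral weighted shift $W_\alpha:\ell^2(\mathbb{N})\to\ell^2(\mathbb{N})$ is $W_\alpha(x_0,x_1,\dots):=(0,\alpha_0x_0,\alpha_1x_1,\dots)$. For a bounded operator $T$ on a Hilbert space, $|T|:=(T^*T)^{1/2}$, and the canonical polar decomposition is $T=V|T|$ where $V$ is the partial isometry with null space $\mathcal{N}(V)=\mathcal{N}(T)$. The mean transform of $T$ is $\widehat{T}:=\frac12(V|T|+|T|V)$. Its iterates are $\widehat{T}^{(0)}:=T$ and $\widehat{T}^{(n+1)}:=\widehat{\widehat{T}^{(n)}}$, i.e. the mean transform of $\widehat{T}^{(n)}$. The sequence $(\|\widehat{T}^{(n)}\|)_{n\in\mathbb{N}}$ is non-increasing, and the mean limit of $T$ is $\ell(T):=\lim_{n\to\infty}\|\widehat{T}^{(n)}\|=\inf_{n}\|\widehat{T}^{(n)}\|$. *)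

theory Defs
  imports "HOL-Analysis.Analysis"
begin

section \<open>Complex Hilbert spaces\<close>

text \<open>The real inner product, and hence the norm, is the one induced by the real part of the
  complex one. Positive definiteness of \<open>cinner\<close> is inherited from \<^class>\<open>real_inner\<close>.\<close>

class complex_hilbert = real_inner + complete_space +
  fixes scaleC :: "complex \<Rightarrow> 'a \<Rightarrow> 'a" (infixr "*\<^sub>C" 75)
    and cinner :: "'a \<Rightarrow> 'a \<Rightarrow> complex"
  assumes scaleC_add_right: "a *\<^sub>C (x + y) = a *\<^sub>C x + a *\<^sub>C y"
    and scaleC_add_left: "(a + b) *\<^sub>C x = a *\<^sub>C x + b *\<^sub>C x"
    and scaleC_scaleC: "a *\<^sub>C (b *\<^sub>C x) = (a * b) *\<^sub>C x"
    and scaleR_scaleC: "r *\<^sub>R x = complex_of_real r *\<^sub>C x"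
    and cinner_commute: "cinner x y = cnj (cinner y x)"
    and cinner_add_left: "cinner (x + y) z = cinner x z + cinner y z"
    and cinner_scaleC_left: "cinner (a *\<^sub>C x) y = a * cinner x y"
    and inner_eq_Re_cinner: "inner x y = Re (cinner x y)"


section \<open>Bounded operators\<close>

text \<open>Operators are plain functions; their norm is \<^const>\<open>onorm\<close>.\<close>

definition bounded_op :: "('a::complex_hilbert \<Rightarrow> 'a) \<Rightarrow> bool" where
  "bounded_op T \<longleftrightarrow> bounded_linear T \<and> (\<forall>c x. T (c *\<^sub>C x) = c *\<^sub>C T x)"

definition adjoint_op :: "('a::complex_hilbert \<Rightarrow> 'a) \<Rightarrow> 'a \<Rightarrow> 'a" where
  "adjoint_op T = (THE S. bounded_op S \<and> (\<forall>x y. cinner (T x) y = cinner x (S y)))"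

definition positive_op :: "('a::complex_hilbert \<Rightarrow> 'a) \<Rightarrow> bool" where
  "positive_op A \<longleftrightarrow> bounded_op A \<and> (\<forall>x. cinner (A x) x \<in> \<real> \<and> 0 \<le> Re (cinner (A x) x))"

definition sqrt_op :: "('a::complex_hilbert \<Rightarrow> 'a) \<Rightarrow> 'a \<Rightarrow> 'a" where
  "sqrt_op B = (THE A. positive_op A \<and> A \<circ> A = B)"

definition abs_op :: "('a::complex_hilbert \<Rightarrow> 'a) \<Rightarrow> 'a \<Rightarrow> 'a" where
  "abs_op T = sqrt_op (adjoint_op T \<circ> T)"

definition null_space :: "('a::complex_hilbert \<Rightarrow> 'a) \<Rightarrow> 'a set" where
  "null_space T = {x. T x = 0}"

definition partial_isometry :: "('a::complex_hilbert \<Rightarrow> 'a) \<Rightarrow> bool" where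
  "partial_isometry V \<longleftrightarrow> bounded_op V \<and>
     (\<forall>x. (\<forall>y\<in>null_space V. cinner x y = 0) \<longrightarrow> norm (V x) = norm x)"

definition polar_part :: "('a::complex_hilbert \<Rightarrow> 'a) \<Rightarrow> 'a \<Rightarrow> 'a" where
  "polar_part T =
     (THE V. partial_isometry V \<and> null_space V = null_space T \<and> T = V \<circ> abs_op T)"

definition op_spectrum :: "('a::complex_hilbert \<Rightarrow> 'a) \<Rightarrow> complex set" where
  "op_spectrum T = {c. \<not> (\<exists>S. bounded_op S \<and>
     S \<circ> (\<lambda>x. T x - c *\<^sub>C x) = id \<and> (\<lambda>x. T x - c *\<^sub>C x) \<circ> S = id)}"

definition spectral_radius :: "('a::complex_hilbert \<Rightarrow> 'a) \<Rightarrow> real" where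
  "spectral_radius T = (SUP c\<in>op_spectrum T. cmod c)"


section \<open>Mean transform\<close>

definition mean_transform :: "('a::complex_hilbert \<Rightarrow> 'a) \<Rightarrow> 'a \<Rightarrow> 'a" where
  "mean_transform T =
     (\<lambda>x. (1/2) *\<^sub>R (polar_part T (abs_op T x) + abs_op T (polar_part T x)))"

definition mean_limit :: "('a::complex_hilbert \<Rightarrow> 'a) \<Rightarrow> real" where
  "mean_limit T = lim (\<lambda>n. onorm ((mean_transform ^^ n) T))"


section \<open>The space of square-summable sequences\<close>

typedef ell2 = "{x :: nat \<Rightarrow> complex. summable (\<lambda>i. (cmod (x i))\<^sup>2)}"
  morphisms ell2_nth Abs_ell2
  by (rule exI[of _ "\<lambda>_. 0"]) simp

setup_lifting type_definition_ell2

lemma summable_ell2: "summable (\<lambda>i. (cmod (ell2_nth x i))\<^sup>2)"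
  using ell2_nth by (rule CollectD)

lemma ell2_eqI: "(\<And>i. ell2_nth x i = ell2_nth y i) \<Longrightarrow> x = y"
  by (simp add: ell2_nth_inject[symmetric] fun_eq_iff)

lemma summable_cmod_add:
  assumes "summable (\<lambda>i. (cmod (x i))\<^sup>2)" "summable (\<lambda>i. (cmod (y i))\<^sup>2)"
  shows "summable (\<lambda>i. (cmod (x i + y i :: complex))\<^sup>2)"
proof (rule summable_comparison_test')
  show "summable (\<lambda>i. 2 * (cmod (x i))\<^sup>2 + 2 * (cmod (y i))\<^sup>2)"
    using assms by (intro summable_add summable_mult)
  show "norm ((cmod (x i + y i))\<^sup>2) \<le> 2 * (cmod (x i))\<^sup>2 + 2 * (cmod (y i))\<^sup>2"
    if "i \<ge> 0" for i
  proof -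
    have "(cmod (x i + y i))\<^sup>2 \<le> (cmod (x i) + cmod (y i))\<^sup>2"
      by (intro power_mono norm_triangle_ineq) auto
    also have "\<dots> \<le> 2 * (cmod (x i))\<^sup>2 + 2 * (cmod (y i))\<^sup>2"
      using sum_squares_bound[of "cmod (x i)" "cmod (y i)"]
      by (simp add: power2_sum)
    finally show ?thesis by simp
  qed
qed

lemma summable_cmod_scale:
  assumes "summable (\<lambda>i. (cmod (x i))\<^sup>2)"
  shows "summable (\<lambda>i. (cmod (c * x i :: complex))\<^sup>2)"
  unfolding norm_mult power_mult_distrib by (rule summable_mult[OF assms])

lemma summable_ell2_prod: "summable (\<lambda>i. ell2_nth x i * cnj (ell2_nth y i))"
proof (rule summable_comparison_test')
  show "summable (\<lambda>i. (cmod (ell2_nth x i))\<^sup>2 + (cmod (ell2_nth y i))\<^sup>2)"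
    by (intro summable_add summable_ell2)
  show "norm (ell2_nth x i * cnj (ell2_nth y i))
      \<le> (cmod (ell2_nth x i))\<^sup>2 + (cmod (ell2_nth y i))\<^sup>2" if "i \<ge> 0" for i
  proof -
    have "0 \<le> cmod (ell2_nth x i) * cmod (ell2_nth y i)" by simp
    thus ?thesis
      using sum_squares_bound[of "cmod (ell2_nth x i)" "cmod (ell2_nth y i)"]
      unfolding norm_mult complex_mod_cnj mult.assoc by linarith
  qed
qed

instantiation ell2 :: real_inner
begin

lift_definition zero_ell2 :: ell2 is "\<lambda>_. 0" by simp

lift_definition plus_ell2 :: "ell2 \<Rightarrow> ell2 \<Rightarrow> ell2" is "\<lambda>x y i. x i + y i"
  by (rule summable_cmod_add)

lift_definition uminus_ell2 :: "ell2 \<Rightarrow> ell2" is "\<lambda>x i. - x i" by simp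

definition minus_ell2 :: "ell2 \<Rightarrow> ell2 \<Rightarrow> ell2" where "minus_ell2 x y = x + (- y)"

lift_definition scaleR_ell2 :: "real \<Rightarrow> ell2 \<Rightarrow> ell2" is "\<lambda>r x i. complex_of_real r * x i"
  by (rule summable_cmod_scale)

definition inner_ell2 :: "ell2 \<Rightarrow> ell2 \<Rightarrow> real" where
  "inner_ell2 x y = Re (\<Sum>i. ell2_nth x i * cnj (ell2_nth y i))"

definition norm_ell2 :: "ell2 \<Rightarrow> real" where
  "norm_ell2 x = sqrt (\<Sum>i. (cmod (ell2_nth x i))\<^sup>2)"

definition dist_ell2 :: "ell2 \<Rightarrow> ell2 \<Rightarrow> real" where "dist_ell2 x y = norm (x - y)"

definition sgn_ell2 :: "ell2 \<Rightarrow> ell2" where "sgn_ell2 x = inverse (norm x) *\<^sub>R x"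

definition uniformity_ell2 :: "(ell2 \<times> ell2) filter" where
  "uniformity_ell2 = (INF e\<in>{0<..}. principal {(x, y). dist x y < e})"

definition open_ell2 :: "ell2 set \<Rightarrow> bool" where
  "open_ell2 U = (\<forall>x\<in>U. \<forall>\<^sub>F (x', y) in uniformity. x' = x \<longrightarrow> y \<in> U)"

instance
proof
  fix x y z :: ell2 and r s :: real
  show "x + y + z = x + (y + z)" by transfer (simp add: add.assoc)
  show "x + y = y + x" by transfer (simp add: add.commute)
  show "0 + x = x" by transfer simp
  show "- x + x = 0" by transfer simp
  show "x - y = x + - y" by (simp add: minus_ell2_def)
  show "r *\<^sub>R (x + y) = r *\<^sub>R x + r *\<^sub>R y" by transfer (simp add: algebra_simps)
  show "(r + s) *\<^sub>R x = r *\<^sub>R x + s *\<^sub>R x" by transfer (simp add: algebra_simps)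
  show "r *\<^sub>R s *\<^sub>R x = (r * s) *\<^sub>R x" by transfer (simp add: algebra_simps)
  show "1 *\<^sub>R x = x" by transfer simp
  show "dist x y = norm (x - y)" by (simp add: dist_ell2_def)
  show "sgn x = inverse (norm x) *\<^sub>R x" by (simp add: sgn_ell2_def)
  show "uniformity = (INF e\<in>{0<..}. principal {(x :: ell2, y). dist x y < e})"
    by (simp add: uniformity_ell2_def)
  show "open U = (\<forall>x\<in>U. \<forall>\<^sub>F (x', y) in uniformity. x' = x \<longrightarrow> y \<in> U)" for U :: "ell2 set"
    by (simp add: open_ell2_def)
  have Re_sum: "Re (\<Sum>i. ell2_nth x i * cnj (ell2_nth y i))
      = (\<Sum>i. Re (ell2_nth x i * cnj (ell2_nth y i)))"
    and Re_summable: "summable (\<lambda>i. Re (ell2_nth x i * cnj (ell2_nth y i)))" for x y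
    by (rule Re_suminf[OF summable_ell2_prod], rule summable_Re[OF summable_ell2_prod])
  have inner_self: "inner x x = (\<Sum>i. (cmod (ell2_nth x i))\<^sup>2)" for x :: ell2
    unfolding inner_ell2_def Re_sum cmod_power2 by (simp add: power2_eq_square)
  show "inner x y = inner y x"
    unfolding inner_ell2_def Re_sum by (simp add: mult.commute add.commute)
  show "inner (x + y) z = inner x z + inner y z"
    unfolding inner_ell2_def Re_sum suminf_add[OF Re_summable Re_summable]
    by (simp add: plus_ell2.rep_eq algebra_simps)
  show "inner (r *\<^sub>R x) y = r * inner x y"
    unfolding inner_ell2_def Re_sum suminf_mult[OF Re_summable, symmetric]
    by (simp add: scaleR_ell2.rep_eq algebra_simps)
  show "0 \<le> inner x x"
    unfolding inner_self by (simp add: suminf_nonneg summable_ell2)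
  show "inner x x = 0 \<longleftrightarrow> x = 0"
    unfolding inner_self using suminf_eq_zero_iff[OF summable_ell2[of x]]
    by (auto intro: ell2_eqI simp: zero_ell2.rep_eq)
  show "norm x = sqrt (inner x x)"
    unfolding inner_self by (simp add: norm_ell2_def)
qed

end

lemma ell2_nth_diff: "ell2_nth (x - y) i = ell2_nth x i - ell2_nth y i"
  unfolding minus_ell2_def plus_ell2.rep_eq uminus_ell2.rep_eq by (rule add_uminus_conv_diff)

lemma norm_ell2_sq: "(norm x)\<^sup>2 = (\<Sum>i. (cmod (ell2_nth x i))\<^sup>2)"
  unfolding norm_ell2_def
  by (rule real_sqrt_pow2, rule suminf_nonneg[OF summable_ell2], rule zero_le_power2)

lemma sum_le_norm_ell2: "(\<Sum>i<n. (cmod (ell2_nth x i))\<^sup>2) \<le> (norm x)\<^sup>2"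
  unfolding norm_ell2_sq by (rule sum_le_suminf[OF summable_ell2]) auto

lemma cmod_le_norm_ell2: "cmod (ell2_nth x i) \<le> norm x"
proof -
  have "(cmod (ell2_nth x i))\<^sup>2 \<le> (norm x)\<^sup>2"
    by (rule order_trans[OF member_le_sum sum_le_norm_ell2[of x "Suc i"]]) auto
  thus ?thesis by (rule power2_le_imp_le) simp
qed

lemma norm_ell2_le:
  assumes "\<And>n. (\<Sum>i<n. (cmod (ell2_nth x i))\<^sup>2) \<le> e\<^sup>2" "0 \<le> e"
  shows "norm x \<le> e"
proof -
  have "(norm x)\<^sup>2 \<le> e\<^sup>2"
    unfolding norm_ell2_sq by (rule suminf_le_const[OF summable_ell2 assms(1)])
  thus ?thesis using assms(2) by (rule power2_le_imp_le)
qed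

instance ell2 :: complete_space
proof
  fix X :: "nat \<Rightarrow> ell2"
  assume X: "Cauchy X"
  have "Cauchy (\<lambda>n. ell2_nth (X n) i)" for i
  proof (rule CauchyI)
    fix e :: real assume "0 < e"
    then obtain M where "\<forall>m\<ge>M. \<forall>n\<ge>M. norm (X m - X n) < e" using CauchyD[OF X] by blast
    thus "\<exists>M. \<forall>m\<ge>M. \<forall>n\<ge>M. norm (ell2_nth (X m) i - ell2_nth (X n) i) < e"
      using cmod_le_norm_ell2 by (metis ell2_nth_diff le_less_trans)
  qed
  hence "\<exists>l. (\<lambda>n. ell2_nth (X n) i) \<longlonglongrightarrow> l" for i
    by (simp add: Cauchy_convergent_iff convergent_def)
  then obtain l where l: "\<And>i. (\<lambda>n. ell2_nth (X n) i) \<longlonglongrightarrow> l i" by metis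
  have bound: "(\<Sum>i<k. (cmod (ell2_nth (X m) i - l i))\<^sup>2) \<le> e\<^sup>2"
    if "\<forall>m\<ge>M. \<forall>n\<ge>M. norm (X m - X n) < e" "m \<ge> M" for e M m k
  proof (rule LIMSEQ_le_const2)
    show "(\<lambda>n. \<Sum>i<k. (cmod (ell2_nth (X m) i - ell2_nth (X n) i))\<^sup>2)
        \<longlonglongrightarrow> (\<Sum>i<k. (cmod (ell2_nth (X m) i - l i))\<^sup>2)"
      by (intro tendsto_intros l)
    have "(\<Sum>i<k. (cmod (ell2_nth (X m) i - ell2_nth (X n) i))\<^sup>2) \<le> e\<^sup>2" if "n \<ge> M" for n
    proof -
      have "(norm (X m - X n))\<^sup>2 \<le> e\<^sup>2"
        using \<open>m \<ge> M\<close> \<open>n \<ge> M\<close> \<open>\<forall>m\<ge>M. \<forall>n\<ge>M. norm (X m - X n) < e\<close>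
        by (intro power_mono) (auto intro: less_imp_le)
      thus ?thesis using sum_le_norm_ell2[of "X m - X n" k] by (simp add: ell2_nth_diff)
    qed
    thus "\<exists>N. \<forall>n\<ge>N. (\<Sum>i<k. (cmod (ell2_nth (X m) i - ell2_nth (X n) i))\<^sup>2) \<le> e\<^sup>2" by blast
  qed
  have summ: "summable (\<lambda>i. (cmod (ell2_nth (X m) i - l i))\<^sup>2)"
    if "\<forall>m\<ge>M. \<forall>n\<ge>M. norm (X m - X n) < e" "m \<ge> M" for e M m
    using bound[OF that] by (intro bounded_imp_summable[of _ "e\<^sup>2"])
      (auto simp: lessThan_Suc_atMost[symmetric] simp del: sum.lessThan_Suc)
  obtain M where M: "\<forall>m\<ge>M. \<forall>n\<ge>M. norm (X m - X n) < 1"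
    using CauchyD[OF X, of 1] by auto
  have "summable (\<lambda>i. (cmod (ell2_nth (X M) i + (-1) * (ell2_nth (X M) i - l i)))\<^sup>2)"
    by (rule summable_cmod_add[OF summable_ell2 summable_cmod_scale[OF summ[OF M order_refl]]])
  moreover have "ell2_nth (X M) i + (-1) * (ell2_nth (X M) i - l i) = l i" for i by simp
  ultimately have "summable (\<lambda>i. (cmod (l i))\<^sup>2)" by (simp only:)
  hence L: "ell2_nth (Abs_ell2 l) = l" by (simp add: Abs_ell2_inverse)
  have "X \<longlonglongrightarrow> Abs_ell2 l"
  proof (rule LIMSEQ_I)
    fix r :: real assume "0 < r"
    then obtain K where K: "\<forall>m\<ge>K. \<forall>n\<ge>K. norm (X m - X n) < r / 2"
      using CauchyD[OF X, of "r / 2"] by auto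
    have "norm (X n - Abs_ell2 l) \<le> r / 2" if "n \<ge> K" for n
      using bound[OF K that] \<open>0 < r\<close> by (intro norm_ell2_le) (auto simp: ell2_nth_diff L)
    thus "\<exists>K. \<forall>n\<ge>K. norm (X n - Abs_ell2 l) < r" using \<open>0 < r\<close> by force
  qed
  thus "convergent X" by (auto simp: convergent_def)
qed

instantiation ell2 :: complex_hilbert
begin

lift_definition scaleC_ell2 :: "complex \<Rightarrow> ell2 \<Rightarrow> ell2" is "\<lambda>c x i. c * x i"
  by (rule summable_cmod_scale)

definition cinner_ell2 :: "ell2 \<Rightarrow> ell2 \<Rightarrow> complex" where
  "cinner_ell2 x y = (\<Sum>i. ell2_nth x i * cnj (ell2_nth y i))"

instance
proof
  fix x y z :: ell2 and a b :: complex and r :: real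
  show "a *\<^sub>C (x + y) = a *\<^sub>C x + a *\<^sub>C y" by transfer (simp add: algebra_simps)
  show "(a + b) *\<^sub>C x = a *\<^sub>C x + b *\<^sub>C x" by transfer (simp add: algebra_simps)
  show "a *\<^sub>C (b *\<^sub>C x) = (a * b) *\<^sub>C x" by transfer (simp add: algebra_simps)
  show "r *\<^sub>R x = complex_of_real r *\<^sub>C x" by transfer simp
  show "cinner x y = cnj (cinner y x)"
    using sums_cnj[THEN iffD2, OF summable_sums[OF summable_ell2_prod[of y x]], THEN sums_unique]
    by (simp add: cinner_ell2_def mult.commute)
  show "cinner (x + y) z = cinner x z + cinner y z"
    unfolding cinner_ell2_def suminf_add[OF summable_ell2_prod summable_ell2_prod]
    by (simp add: plus_ell2.rep_eq algebra_simps)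
  show "cinner (a *\<^sub>C x) y = a * cinner x y"
    unfolding cinner_ell2_def suminf_mult[OF summable_ell2_prod, symmetric]
    by (simp add: scaleC_ell2.rep_eq algebra_simps)
  show "inner x y = Re (cinner x y)" by (simp add: inner_ell2_def cinner_ell2_def)
qed

end


section \<open>Weighted shifts\<close>

text \<open>Since \<^const>\<open>Abs_ell2\<close> is unspecified outside \<open>\<ell>\<^sup>2\<close>, this is meaningful
  only for bounded weights, as in the lemmas below.\<close>

definition weighted_shift :: "(nat \<Rightarrow> real) \<Rightarrow> ell2 \<Rightarrow> ell2" where
  "weighted_shift \<alpha> x =
     Abs_ell2 (\<lambda>i. case i of 0 \<Rightarrow> 0 | Suc k \<Rightarrow> complex_of_real (\<alpha> k) * ell2_nth x k)"

context
  fixes \<alpha> :: "nat \<Rightarrow> real"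
  assumes bdd: "bounded (range \<alpha>)"
begin

lemma ell2_nth_weighted_shift:
  "ell2_nth (weighted_shift \<alpha> x) i =
     (case i of 0 \<Rightarrow> 0 | Suc k \<Rightarrow> complex_of_real (\<alpha> k) * ell2_nth x k)"
proof -
  obtain B where B: "\<And>k. \<bar>\<alpha> k\<bar> \<le> B" using bdd by (auto simp: bounded_iff)
  have "summable (\<lambda>k. (cmod (complex_of_real (\<alpha> k) * ell2_nth x k))\<^sup>2)"
  proof (rule summable_comparison_test')
    show "summable (\<lambda>k. B\<^sup>2 * (cmod (ell2_nth x k))\<^sup>2)"
      by (intro summable_mult summable_ell2)
    show "norm ((cmod (complex_of_real (\<alpha> k) * ell2_nth x k))\<^sup>2) \<le> B\<^sup>2 * (cmod (ell2_nth x k))\<^sup>2"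
      if "k \<ge> 0" for k
      using power_mono[OF B[of k], of 2]
      by (simp add: norm_mult power_mult_distrib mult_right_mono)
  qed
  hence "summable (\<lambda>i. (cmod (case i of 0 \<Rightarrow> 0
      | Suc k \<Rightarrow> complex_of_real (\<alpha> k) * ell2_nth x k))\<^sup>2)"
    by (subst summable_Suc_iff[symmetric]) simp
  thus ?thesis by (simp add: weighted_shift_def Abs_ell2_inverse)
qed

lemma bounded_op_weighted_shift: "bounded_op (weighted_shift \<alpha>)"
proof -
  obtain B where B: "\<And>k. \<bar>\<alpha> k\<bar> \<le> B" using bdd by (auto simp: bounded_iff)
  have B0: "0 \<le> B" using B[of 0] by simp
  have "norm (weighted_shift \<alpha> x) \<le> norm x * B" for x
  proof (rule norm_ell2_le)
    fix n
    have "(\<Sum>i<n. (cmod (ell2_nth (weighted_shift \<alpha> x) i))\<^sup>2)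
        \<le> (\<Sum>i<Suc n. (cmod (ell2_nth (weighted_shift \<alpha> x) i))\<^sup>2)" by simp
    also have "\<dots> = (\<Sum>k<n. (\<alpha> k)\<^sup>2 * (cmod (ell2_nth x k))\<^sup>2)"
      by (simp add: sum.lessThan_Suc_shift ell2_nth_weighted_shift norm_mult power_mult_distrib
          del: sum.lessThan_Suc)
    also have "\<dots> \<le> (\<Sum>k<n. B\<^sup>2 * (cmod (ell2_nth x k))\<^sup>2)"
      using power_mono[OF B abs_ge_zero, of _ 2] by (intro sum_mono mult_right_mono) auto
    also have "\<dots> \<le> (norm x * B)\<^sup>2"
      using sum_le_norm_ell2[of x n]
      by (simp add: sum_distrib_left[symmetric] power_mult_distrib mult.commute mult_left_mono)
    finally show "(\<Sum>i<n. (cmod (ell2_nth (weighted_shift \<alpha> x) i))\<^sup>2) \<le> (norm x * B)\<^sup>2" .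
  qed (simp add: B0)
  moreover have "weighted_shift \<alpha> (x + y) = weighted_shift \<alpha> x + weighted_shift \<alpha> y"
    and "weighted_shift \<alpha> (r *\<^sub>R x) = r *\<^sub>R weighted_shift \<alpha> x"
    and "weighted_shift \<alpha> (c *\<^sub>C x) = c *\<^sub>C weighted_shift \<alpha> x" for x y r c
    by (rule ell2_eqI, simp add: ell2_nth_weighted_shift plus_ell2.rep_eq scaleR_ell2.rep_eq
        scaleC_ell2.rep_eq algebra_simps split: nat.split)+
  ultimately show ?thesis
    unfolding bounded_op_def by (blast intro: bounded_linear_intro)
qed

end

end

(* W = U D with U the unilateral shift and D = diag a, so the mean transform of W_a is the shift whose
   weights are averages of neighbouring weights, and its iterates have binomial averages of a as
   weights. Let M be the limit of the largest mean of n consecutive weights. The total variation of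
   the binomial distribution is O(1/sqrt n), so binomial averages are almost invariant under
   translation; comparing them with consecutive means gives mean limit M. Products of consecutive
   weights exp (a_i) are exponentials of sums, so the Neumann series and the explicit coordinates of
   the resolvent on basis vectors give r(W_exp a) = exp M. Finally a / L <= exp (a / L - 1)
   bounds products of weights a_i by sums, whence r(W_a) <= M. *)

theory Submission
  imports Defs "HOL-Real_Asymp.Real_Asymp"
begin

section \<open>Operators on complex Hilbert spaces\<close>

text \<open>The norm is induced by the real inner product, so complex homogeneity has to be derived:
  conjugate symmetry pulls \<open>a\<close> out of one slot of \<open>cinner\<close> and
  \<open>cnj a\<close> out of the other.\<close>

lemma norm_scaleC: "norm (a *\<^sub>C x) = cmod a * norm x" for x :: "'a::complex_hilbert"
proof -
  have "cinner (a *\<^sub>C x) (a *\<^sub>C x) = (a * cnj a) * cnj (cinner x x)"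
    by (subst cinner_scaleC_left, subst cinner_commute, subst cinner_scaleC_left) simp
  moreover have "cnj (cinner x x) = cinner x x"
    using cinner_commute[of x x] by simp
  ultimately have "(norm (a *\<^sub>C x))\<^sup>2 = (cmod a * norm x)\<^sup>2"
    by (simp add: power2_norm_eq_inner inner_eq_Re_cinner complex_norm_square[symmetric] power_mult_distrib
        del: of_real_power)
  thus ?thesis by (simp add: power2_eq_imp_eq)
qed

lemma scaleC_one [simp]: "1 *\<^sub>C x = x" for x :: "'a::complex_hilbert"
  using scaleR_scaleC[of 1 x] by simp

lemma scaleC_zero_right [simp]: "a *\<^sub>C 0 = 0"
  using scaleC_add_right[of a 0 0] by (metis add_cancel_left_left add_0)

lemma bounded_linear_scaleC: "bounded_linear (\<lambda>x. a *\<^sub>C x)"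
  for a :: complex
  by (rule bounded_linear_intro[where K = "cmod a"])
    (simp_all add: scaleC_add_right scaleR_scaleC scaleC_scaleC norm_scaleC mult.commute)

lemma scaleC_diff_right: "a *\<^sub>C (x - y) = a *\<^sub>C x - a *\<^sub>C y" for x :: "'a::complex_hilbert"
  by (rule linear_diff[OF bounded_linear.linear[OF bounded_linear_scaleC]])

lemma scaleC_minus_right: "a *\<^sub>C (- x) = - (a *\<^sub>C x)" for x :: "'a::complex_hilbert"
  using scaleC_diff_right[of a 0 x] by simp

lemma scaleC_minus_left: "(- a) *\<^sub>C x = - (a *\<^sub>C x)" for x :: "'a::complex_hilbert"
  using scaleC_scaleC[of "- 1" a x] scaleR_scaleC[of "- 1" "a *\<^sub>C x"] by simp

lemma bounded_opD:
  assumes "bounded_op T"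
  shows "bounded_linear T" "T (c *\<^sub>C x) = c *\<^sub>C T x"
  using assms by (auto simp: bounded_op_def)

lemma bounded_op_funpow: "bounded_op T \<Longrightarrow> bounded_op (T ^^ n)"
proof (induction n)
  case 0
  show ?case by (simp add: bounded_op_def id_def bounded_linear_ident)
next
  case (Suc n)
  thus ?case
    using bounded_linear_compose[of T "T ^^ n"] by (simp add: bounded_op_def o_def)
qed

section \<open>Neumann series\<close>

text \<open>The bound makes the series of \<open>f m x = - (T ^^ m) x / c ^ Suc m\<close> converge
  geometrically with ratio \<open>\<rho> / cmod c\<close>; its sum is a bounded two-sided inverse of
  \<open>T - c\<close>.\<close>

lemma notin_op_spectrum_of_power_bound:
  fixes T :: "'a::{complex_hilbert, banach} \<Rightarrow> 'a"
  assumes T: "bounded_op T"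
    and bound: "\<And>m x. norm ((T ^^ m) x) \<le> K * \<rho> ^ m * norm x"
    and "0 \<le> \<rho>" "\<rho> < cmod c"
  shows "c \<notin> op_spectrum T"
proof -
  have c: "c \<noteq> 0" using assms by auto
  define f where "f m x = - ((1 / c ^ Suc m) *\<^sub>C (T ^^ m) x)" for m x
  define h where "h m x = (1 / c ^ m) *\<^sub>C (T ^^ m) x" for m x
  define q where "q m = K / cmod c * (\<rho> / cmod c) ^ m" for m
  note blT = bounded_opD(1)[OF T]
  note blTm = bounded_opD(1)[OF bounded_op_funpow[OF T]]
  note scT = bounded_opD(2)[OF T] bounded_opD(2)[OF bounded_op_funpow[OF T]]
  have q: "summable q"
    unfolding q_def using assms c by (intro summable_mult summable_geometric) simp
  have f_le: "norm (f m x) \<le> q m * norm x" for m x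
    using mult_left_mono[OF bound[of m x], of "1 / cmod c ^ Suc m"]
    by (simp add: f_def q_def norm_scaleC norm_divide norm_power norm_mult power_divide mult_ac)
  have f_norm: "summable (\<lambda>m. norm (f m x))" for x
    by (rule summable_comparison_test'[OF summable_mult2[OF q]]) (use f_le in auto)
  have f_summ: "summable (\<lambda>m. f m x)" for x
    by (rule summable_norm_cancel[OF f_norm])
  have h_eq: "h m x = (- c) *\<^sub>C f m x" for m x
    using c by (simp add: h_def f_def scaleC_minus_right scaleC_scaleC scaleC_minus_left)
  have "(\<lambda>m. h m x) \<longlonglongrightarrow> 0" for x
    unfolding h_eq
    using bounded_linear.tendsto[OF bounded_linear_scaleC summable_LIMSEQ_zero[OF f_summ]]
    by fastforce
  \<comment> \<open>Applying \<open>T - c\<close> to \<open>f m x\<close>, or \<open>f m\<close> to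
    \<open>T x - c x\<close>, gives \<open>h m x - h (Suc m) x\<close>, so both compositions
    telescope to \<open>h 0 x = x\<close>.\<close>
  from telescope_sums'[OF this] have tele: "(\<lambda>m. h m x - h (Suc m) x) sums x" for x
    by (simp add: h_def)
  define S where "S x = (\<Sum>m. f m x)" for x
  have TS: "T (S x) - c *\<^sub>C S x = x" for x
  proof -
    have "(\<lambda>m. T (f m x) - c *\<^sub>C f m x) sums (T (S x) - c *\<^sub>C S x)"
      unfolding S_def
      by (intro sums_diff bounded_linear.sums[OF blT] bounded_linear.sums[OF bounded_linear_scaleC]
          summable_sums f_summ)
    moreover have "T (f m x) - c *\<^sub>C f m x = h m x - h (Suc m) x" for m
      using c by (simp add: f_def h_def scT linear_neg[OF bounded_linear.linear[OF blT]] scaleC_minus_right scaleC_scaleC)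
    ultimately show ?thesis using tele sums_unique2 by (metis (no_types, lifting) ext)
  qed
  have ST: "S (T x - c *\<^sub>C x) = x" for x
  proof -
    have "f m (T x - c *\<^sub>C x) = h m x - h (Suc m) x" for m
      using c
      by (simp add: f_def h_def scT linear_diff[OF bounded_linear.linear[OF blTm]] scaleC_diff_right scaleC_scaleC
          funpow_swap1)
    thus ?thesis using tele[of x] by (simp add: S_def sums_unique[symmetric])
  qed
  have f_lin: "f m (x + y) = f m x + f m y" "f m (r *\<^sub>R x) = r *\<^sub>R f m x"
    "f m (a *\<^sub>C x) = a *\<^sub>C f m x" for m x y r a
    by (simp_all add: f_def linear_add[OF bounded_linear.linear[OF blTm]] linear_scale[OF bounded_linear.linear[OF blTm]] scT
        scaleC_add_right scaleC_scaleC scaleC_minus_right scaleR_scaleC mult.commute)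
  have "bounded_op S"
    unfolding bounded_op_def
  proof (intro conjI allI bounded_linear_intro)
    fix x y r a
    show "S (x + y) = S x + S y" "S (r *\<^sub>R x) = r *\<^sub>R S x"
      by (simp_all add: S_def f_lin suminf_add[OF f_summ f_summ] suminf_scaleR_right[OF f_summ])
    show "S (a *\<^sub>C x) = a *\<^sub>C S x"
      by (simp add: S_def f_lin bounded_linear.suminf[OF bounded_linear_scaleC f_summ])
    have "norm (S x) \<le> (\<Sum>m. norm (f m x))"
      unfolding S_def by (rule summable_norm[OF f_norm])
    also have "\<dots> \<le> (\<Sum>m. q m * norm x)"
      by (rule suminf_le[OF f_le f_norm summable_mult2[OF q]])
    also have "\<dots> = norm x * (\<Sum>m. q m)"
      by (subst suminf_mult2[OF q, symmetric]) (rule mult.commute)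
    finally show "norm (S x) \<le> norm x * (\<Sum>m. q m)" .
  qed
  moreover have "S \<circ> (\<lambda>x. T x - c *\<^sub>C x) = id" "(\<lambda>x. T x - c *\<^sub>C x) \<circ> S = id"
    by (auto simp: fun_eq_iff TS ST)
  ultimately show ?thesis unfolding op_spectrum_def by blast
qed

section \<open>Uniqueness of adjoints\<close>

lemma cinner_left_cancel:
  fixes y z :: "'a::complex_hilbert"
  assumes "\<And>x. cinner x y = cinner x z"
  shows "y = z"
proof -
  have "inner (y - z) y = inner (y - z) z" by (simp add: inner_eq_Re_cinner assms)
  hence "inner (y - z) (y - z) = 0" by (simp add: inner_diff_right)
  thus ?thesis by simp
qed

lemma adjoint_op_eqI:
  assumes "bounded_op S" "\<And>x y. cinner (T x) y = cinner x (S y)"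
  shows "adjoint_op T = S"
  unfolding adjoint_op_def
proof (rule the_equality)
  fix R assume "bounded_op R \<and> (\<forall>x y. cinner (T x) y = cinner x (R y))"
  hence "cinner x (R y) = cinner x (S y)" for x y by (simp flip: assms(2))
  thus "R = S" by (intro ext cinner_left_cancel)
qed (simp add: assms)


section \<open>Basis vectors and diagonal operators\<close>

instance ell2 :: banach ..

lift_definition unit_ell2 :: "nat \<Rightarrow> ell2" is "\<lambda>j i. if i = j then 1 else 0"
  by (rule summable_finite[of "{j}" for j]) auto

lemmas ell2_nth_simps [simp] =
  plus_ell2.rep_eq scaleR_ell2.rep_eq scaleC_ell2.rep_eq zero_ell2.rep_eq ell2_nth_diff
  unit_ell2.rep_eq

lemma norm_unit_ell2 [simp]: "norm (unit_ell2 j) = 1"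
proof -
  have "(\<lambda>i. (cmod (ell2_nth (unit_ell2 j) i))\<^sup>2) = (\<lambda>i. if i = j then 1 else 0)" by auto
  hence "(norm (unit_ell2 j))\<^sup>2 = 1"
    using sums_unique[OF sums_single[of j "\<lambda>_. 1::real"]] by (simp add: norm_ell2_sq)
  thus ?thesis using power2_eq_1_iff[of "norm (unit_ell2 j)"] norm_ge_zero[of "unit_ell2 j"] by linarith
qed

lemma unit_ell2_sums: "(\<lambda>i. ell2_nth x i *\<^sub>C unit_ell2 i) sums x"
proof -
  have nth_sum: "ell2_nth (\<Sum>i<n. ell2_nth x i *\<^sub>C unit_ell2 i) k = (if k < n then ell2_nth x k else 0)"
    for n k
    by (induction n) (auto simp: less_Suc_eq)
  \<comment> \<open>The squared error of the partial sum is a tail of the convergent series for the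
    squared norm.\<close>
  have sq: "(norm ((\<Sum>i<n. ell2_nth x i *\<^sub>C unit_ell2 i) - x))\<^sup>2
      = (\<Sum>i. (cmod (ell2_nth x (i + n)))\<^sup>2)" for n
    unfolding norm_ell2_sq
    by (subst suminf_split_initial_segment[OF summable_ell2, of _ n]) (simp add: nth_sum)
  have "(\<lambda>n. \<Sum>i. (cmod (ell2_nth x (i + n)))\<^sup>2) \<longlonglongrightarrow> 0"
    by (rule suminf_exist_split2[OF summable_ell2])
  hence "(\<lambda>n. sqrt ((norm ((\<Sum>i<n. ell2_nth x i *\<^sub>C unit_ell2 i) - x))\<^sup>2)) \<longlonglongrightarrow> 0"
    using tendsto_real_sqrt unfolding sq by fastforce
  hence "(\<lambda>n. norm ((\<Sum>i<n. ell2_nth x i *\<^sub>C unit_ell2 i) - x)) \<longlonglongrightarrow> 0" by simp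
  thus ?thesis unfolding sums_def by (rule LIM_zero_cancel[OF tendsto_norm_zero_cancel])
qed

text \<open>Continuity extends agreement from the basis to all expansions. This provides the
  uniqueness demanded by the definite descriptions in \<open>sqrt_op\<close> and
  \<open>polar_part\<close>.\<close>

lemma bounded_op_eqI:
  assumes "bounded_op S" "bounded_op T" "\<And>i. S (unit_ell2 i) = T (unit_ell2 i)"
  shows "S = T"
proof
  fix x
  have "(\<lambda>i. S (ell2_nth x i *\<^sub>C unit_ell2 i)) sums S x"
    "(\<lambda>i. T (ell2_nth x i *\<^sub>C unit_ell2 i)) sums T x"
    by (rule bounded_linear.sums[OF bounded_opD(1)[OF assms(1)] unit_ell2_sums],
      rule bounded_linear.sums[OF bounded_opD(1)[OF assms(2)] unit_ell2_sums])
  thus "S x = T x" by (simp add: bounded_opD(2) assms sums_unique2)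
qed

section \<open>Weighted coordinate maps\<close>

text \<open>One construction covers two operators: \<open>g = id\<close> gives diagonal operators
  and \<open>g = Suc\<close> gives the backward shift that is the adjoint of
  \<open>weighted_shift a\<close>.\<close>

definition weighted_comp :: "(nat \<Rightarrow> nat) \<Rightarrow> (nat \<Rightarrow> real) \<Rightarrow> ell2 \<Rightarrow> ell2" where
  "weighted_comp g a x = Abs_ell2 (\<lambda>i. complex_of_real (a i) * ell2_nth x (g i))"

context
  fixes a :: "nat \<Rightarrow> real" and g :: "nat \<Rightarrow> nat"
  assumes bdd: "bounded (range a)" and inj: "inj g"
begin

text \<open>Injectivity of \<open>g\<close> ensures that no coordinate of \<open>x\<close> is
  counted twice. Bounding partial sums serves twice: it shows first that the image sequence is
  square-summable, then that the operator is bounded.\<close>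

lemma ex_weighted_comp_bound:
  "\<exists>B\<ge>0. \<forall>x n. (\<Sum>i<n. (cmod (complex_of_real (a i) * ell2_nth x (g i)))\<^sup>2) \<le> (norm x * B)\<^sup>2"
proof -
  obtain B where B: "\<And>k. \<bar>a k\<bar> \<le> B" using bdd by (auto simp: bounded_iff)
  have "(\<Sum>i<n. (cmod (complex_of_real (a i) * ell2_nth x (g i)))\<^sup>2) \<le> (norm x * B)\<^sup>2" for x n
  proof -
    have "(\<Sum>i<n. (cmod (complex_of_real (a i) * ell2_nth x (g i)))\<^sup>2)
        \<le> (\<Sum>i<n. B\<^sup>2 * (cmod (ell2_nth x (g i)))\<^sup>2)"
      using power_mono[OF B abs_ge_zero, of _ 2]
      by (intro sum_mono) (simp add: norm_mult power_mult_distrib mult_right_mono)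
    also have "\<dots> = B\<^sup>2 * (\<Sum>k\<in>g ` {..<n}. (cmod (ell2_nth x k))\<^sup>2)"
      using inj by (simp add: sum_distrib_left sum.reindex inj_on_def)
    also have "\<dots> \<le> B\<^sup>2 * (norm x)\<^sup>2"
      unfolding norm_ell2_sq by (intro mult_left_mono sum_le_suminf summable_ell2) auto
    finally show ?thesis by (simp add: power_mult_distrib mult.commute)
  qed
  moreover have "0 \<le> B" using B[of 0] by simp
  ultimately show ?thesis by blast
qed

lemma ell2_nth_weighted_comp:
  "ell2_nth (weighted_comp g a x) i = complex_of_real (a i) * ell2_nth x (g i)"
proof -
  obtain B where "\<And>n. (\<Sum>i<n. (cmod (complex_of_real (a i) * ell2_nth x (g i)))\<^sup>2) \<le> (norm x * B)\<^sup>2"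
    using ex_weighted_comp_bound by blast
  hence "summable (\<lambda>i. (cmod (complex_of_real (a i) * ell2_nth x (g i)))\<^sup>2)"
    by (intro bounded_imp_summable[of _ "(norm x * B)\<^sup>2"])
      (auto simp: lessThan_Suc_atMost[symmetric] simp del: sum.lessThan_Suc)
  thus ?thesis by (simp add: weighted_comp_def Abs_ell2_inverse)
qed

lemma bounded_op_weighted_comp: "bounded_op (weighted_comp g a)"
proof -
  obtain B where "0 \<le> B"
    "\<And>x n. (\<Sum>i<n. (cmod (complex_of_real (a i) * ell2_nth x (g i)))\<^sup>2) \<le> (norm x * B)\<^sup>2"
    using ex_weighted_comp_bound by blast
  hence "norm (weighted_comp g a x) \<le> norm x * B" for x
    by (intro norm_ell2_le) (simp_all add: ell2_nth_weighted_comp)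
  moreover have "weighted_comp g a (x + y) = weighted_comp g a x + weighted_comp g a y"
    and "weighted_comp g a (r *\<^sub>R x) = r *\<^sub>R weighted_comp g a x"
    and "weighted_comp g a (c *\<^sub>C x) = c *\<^sub>C weighted_comp g a x" for x y r c
    by (rule ell2_eqI, simp add: ell2_nth_weighted_comp algebra_simps)+
  ultimately show ?thesis
    unfolding bounded_op_def by (blast intro: bounded_linear_intro)
qed

end

section \<open>Diagonal operators and their square roots\<close>

abbreviation diag_op :: "(nat \<Rightarrow> real) \<Rightarrow> ell2 \<Rightarrow> ell2" where
  "diag_op \<equiv> weighted_comp id"

lemma cinner_diag_op:
  assumes "bounded (range a)"
  shows "(\<lambda>i. complex_of_real (a i * (cmod (ell2_nth x i))\<^sup>2)) sums cinner (diag_op a x) x"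
proof -
  have "(\<lambda>i. ell2_nth (diag_op a x) i * cnj (ell2_nth x i)) sums cinner (diag_op a x) x"
    unfolding cinner_ell2_def by (rule summable_sums[OF summable_ell2_prod])
  thus ?thesis
    by (simp add: ell2_nth_weighted_comp[OF assms inj_on_id] mult.assoc complex_norm_square[symmetric]
        del: of_real_power)
qed

lemma cinner_diag_op_real:
  assumes "bounded (range a)"
  shows "cinner (diag_op a x) x \<in> \<real>"
    "(\<lambda>i. a i * (cmod (ell2_nth x i))\<^sup>2) sums Re (cinner (diag_op a x) x)"
proof -
  note s = cinner_diag_op[OF assms, of x]
  show "cinner (diag_op a x) x \<in> \<real>"
    using sums_unique2[OF sums_Im[OF s]] by (simp add: complex_is_Real_iff)
  show "(\<lambda>i. a i * (cmod (ell2_nth x i))\<^sup>2) sums Re (cinner (diag_op a x) x)"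
    using sums_Re[OF s] by simp
qed

lemma positive_op_diag_op:
  assumes "bounded (range a)" "\<And>i. 0 \<le> a i"
  shows "positive_op (diag_op a)"
  unfolding positive_op_def
proof (intro conjI allI)
  show "0 \<le> Re (cinner (diag_op a x) x)" for x
    by (rule sums_le[OF _ sums_zero cinner_diag_op_real(2)[OF assms(1)]]) (simp add: assms)
qed (rule bounded_op_weighted_comp[OF assms(1) inj_on_id] cinner_diag_op_real[OF assms(1)])+

lemma diag_op_pos_definite:
  assumes "bounded (range a)" "\<And>i. 0 < a i" "Re (cinner (diag_op a x) x) \<le> 0"
  shows "x = 0"
proof (rule ell2_eqI)
  fix i
  note s = cinner_diag_op_real(2)[OF assms(1), of x]
  have "a i * (cmod (ell2_nth x i))\<^sup>2 \<le> Re (cinner (diag_op a x) x)"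
    using sum_le_suminf[OF sums_summable[OF s], of "{i}"] assms(2)
    by (simp add: sums_unique[OF s, symmetric] less_imp_le)
  hence "a i * (cmod (ell2_nth x i))\<^sup>2 \<le> 0" using assms(3) by (rule order_trans)
  thus "ell2_nth x i = ell2_nth 0 i"
    using assms(2)[of i] by (simp add: mult_le_0_iff)
qed

lemma diag_op_unit:
  assumes "bounded (range a)"
  shows "diag_op a (unit_ell2 j) = complex_of_real (a j) *\<^sub>C unit_ell2 j"
  by (rule ell2_eqI) (simp add: ell2_nth_weighted_comp[OF assms inj_on_id])

text \<open>A square root \<open>A\<close> of \<open>D\<^sup>2\<close> commutes with \<open>D\<^sup>2\<close>, so its matrix entries link only
  indices with equal weights; hence \<open>(A + D) (A - D) e\<^sub>j = 0\<close>, and positivity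
  of \<open>A\<close> and \<open>D\<close> forces \<open>A e\<^sub>j = D e\<^sub>j\<close>.\<close>

lemma sqrt_op_diag_op:
  assumes bdd: "bounded (range a)" and pos: "\<And>i. 0 < a i"
  shows "sqrt_op (diag_op a \<circ> diag_op a) = diag_op a"
  unfolding sqrt_op_def
proof (rule the_equality)
  let ?D = "diag_op a"
  note nthD = ell2_nth_weighted_comp[OF bdd inj_on_id]
  have bD: "bounded_op ?D" by (rule bounded_op_weighted_comp[OF bdd inj_on_id])
  show "positive_op ?D \<and> ?D \<circ> ?D = ?D \<circ> ?D"
    using positive_op_diag_op[OF bdd] pos by (simp add: less_imp_le)
  fix A assume A: "positive_op A \<and> A \<circ> A = ?D \<circ> ?D"
  hence AA: "A (A x) = ?D (?D x)" for x by (metis comp_apply)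
  have bA: "bounded_op A" using A by (simp add: positive_op_def)
  show "A = ?D"
  proof (rule bounded_op_eqI[OF bA bD])
    fix j
    let ?e = "unit_ell2 j"
    have "complex_of_real (a j) * ell2_nth (A ?e) i = complex_of_real (a i) * ell2_nth (A ?e) i" for i
    proof -
      have "A (?D (?D ?e)) = ?D (?D (A ?e))" using AA by metis
      hence "ell2_nth (A (?D (?D ?e))) i = ell2_nth (?D (?D (A ?e))) i" by simp
      hence "complex_of_real ((a j)\<^sup>2) * ell2_nth (A ?e) i = complex_of_real ((a i)\<^sup>2) * ell2_nth (A ?e) i"
        by (simp add: diag_op_unit[OF bdd] bounded_opD(2)[OF bA] bounded_opD(2)[OF bD] nthD
            power2_eq_square)
      moreover have "(a i)\<^sup>2 = (a j)\<^sup>2 \<Longrightarrow> a i = a j"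
        using pos[of i] pos[of j] by (simp add: power2_eq_iff_nonneg)
      ultimately show ?thesis
        unfolding mult_cancel_right of_real_eq_iff by metis
    qed
    hence comm: "A (?D ?e) = ?D (A ?e)"
      by (intro ell2_eqI) (simp add: diag_op_unit[OF bdd] bounded_opD(2)[OF bA] nthD)
    define y where "y = A ?e - ?D ?e"
    have "A y = A (A ?e) - A (?D ?e)" "?D y = ?D (A ?e) - ?D (?D ?e)"
      unfolding y_def
      by (rule linear_diff[OF bounded_linear.linear[OF bounded_opD(1)[OF bA]]],
          rule linear_diff[OF bounded_linear.linear[OF bounded_opD(1)[OF bD]]])
    hence "A y + ?D y = 0" unfolding AA comm by simp
    hence "Re (cinner (A y) y) + Re (cinner (?D y) y) = 0"
      unfolding inner_eq_Re_cinner[symmetric] inner_add_left[symmetric] by simp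
    moreover have "0 \<le> Re (cinner (A y) y)" using A by (simp add: positive_op_def)
    ultimately have "y = 0" by (intro diag_op_pos_definite[OF bdd pos]) simp
    thus "A ?e = ?D ?e" by (simp add: y_def)
  qed
qed


section \<open>Weighted shifts\<close>

lemma weighted_shift_unit:
  assumes "bounded (range a)"
  shows "weighted_shift a (unit_ell2 j) = complex_of_real (a j) *\<^sub>C unit_ell2 (Suc j)"
  by (rule ell2_eqI) (simp add: ell2_nth_weighted_shift[OF assms] split: nat.split)

abbreviation unilateral_shift :: "ell2 \<Rightarrow> ell2" where
  "unilateral_shift \<equiv> weighted_shift (\<lambda>_. 1)"

lemma bounded_range_one: "bounded (range (\<lambda>_::nat. 1::real))"
  by simp

lemmas ell2_nth_unilateral_shift = ell2_nth_weighted_shift[OF bounded_range_one]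

lemma norm_unilateral_shift: "norm (unilateral_shift x) = norm x"
proof -
  have "(norm (unilateral_shift x))\<^sup>2 = (norm x)\<^sup>2"
    using suminf_split_head[OF summable_ell2[of "unilateral_shift x"]]
    by (simp add: norm_ell2_sq ell2_nth_unilateral_shift)
  thus ?thesis by (simp add: power2_eq_imp_eq)
qed

section \<open>Adjoint, powers and spectrum of a weighted shift\<close>

context
  fixes a :: "nat \<Rightarrow> real"
  assumes bdd: "bounded (range a)"
begin

lemma adjoint_op_weighted_shift: "adjoint_op (weighted_shift a) = weighted_comp Suc a"
proof (rule adjoint_op_eqI)
  show "bounded_op (weighted_comp Suc a)" by (rule bounded_op_weighted_comp[OF bdd inj_Suc])
  fix x y
  note s = summable_ell2_prod[of "weighted_shift a x" y]
  have "cinner (weighted_shift a x) y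
      = (\<Sum>i. ell2_nth (weighted_shift a x) (Suc i) * cnj (ell2_nth y (Suc i)))"
    using suminf_split_head[OF s] by (simp add: cinner_ell2_def ell2_nth_weighted_shift[OF bdd])
  also have "\<dots> = cinner x (weighted_comp Suc a y)"
    by (simp add: cinner_ell2_def ell2_nth_weighted_shift[OF bdd]
        ell2_nth_weighted_comp[OF bdd inj_Suc] mult_ac)
  finally show "cinner (weighted_shift a x) y = cinner x (weighted_comp Suc a y)" .
qed

text \<open>The \<open>n\<close>-th power moves coordinate \<open>i\<close> to \<open>i + n\<close>
  and multiplies it by the \<open>n\<close> consecutive weights starting at
  \<open>a i\<close>.\<close>

lemma norm_weighted_shift_funpow_le:
  assumes "\<And>j. \<bar>\<Prod>k<n. a (j + k)\<bar> \<le> C"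
  shows "norm ((weighted_shift a ^^ n) x) \<le> C * norm x"
proof (rule norm_ell2_le)
  have nth: "ell2_nth ((weighted_shift a ^^ n) x) i
      = (if i < n then 0 else complex_of_real (\<Prod>k<n. a (i - n + k)) * ell2_nth x (i - n))" for i n
  proof (induction n arbitrary: i)
    case (Suc n)
    show ?case
    proof (cases i)
      case (Suc k)
      thus ?thesis
        by (auto simp: Suc.IH ell2_nth_weighted_shift[OF bdd])
    qed (simp add: ell2_nth_weighted_shift[OF bdd])
  qed simp
  have C: "0 \<le> C" using assms[of 0] by (meson abs_ge_zero order_trans)
  thus "0 \<le> C * norm x" by simp
  fix m
  \<comment> \<open>The range is enlarged to \<open>n + m\<close> because the first \<open>n\<close>
    coordinates vanish, which leaves exactly the first \<open>m\<close> coordinates of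
    \<open>x\<close>.\<close>
  have "(\<Sum>i<m. (cmod (ell2_nth ((weighted_shift a ^^ n) x) i))\<^sup>2)
      \<le> (\<Sum>i<n + m. (cmod (ell2_nth ((weighted_shift a ^^ n) x) i))\<^sup>2)"
    by (rule sum_mono2) auto
  also have "\<dots> = (\<Sum>i<m. (\<bar>\<Prod>k<n. a (i + k)\<bar> * cmod (ell2_nth x i))\<^sup>2)"
  proof -
    have "(\<Sum>i<n + m. (cmod (ell2_nth ((weighted_shift a ^^ n) x) i))\<^sup>2)
        = (\<Sum>i=n..<m + n. (cmod (ell2_nth ((weighted_shift a ^^ n) x) i))\<^sup>2)"
      by (rule sum.mono_neutral_right) (auto simp: nth)
    also have "\<dots> = (\<Sum>i=0..<m. (cmod (ell2_nth ((weighted_shift a ^^ n) x) (i + n)))\<^sup>2)"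
      using sum.shift_bounds_nat_ivl[of _ 0 n m] by simp
    finally show ?thesis
      by (simp add: nth norm_mult atLeast0LessThan del: of_real_prod)
  qed
  also have "\<dots> \<le> (\<Sum>i<m. C\<^sup>2 * (cmod (ell2_nth x i))\<^sup>2)"
    unfolding power_mult_distrib using power_mono[OF assms abs_ge_zero, of _ 2]
    by (intro sum_mono mult_right_mono) auto
  also have "\<dots> \<le> (C * norm x)\<^sup>2"
    using sum_le_norm_ell2[of x m]
    by (simp add: sum_distrib_left[symmetric] power_mult_distrib mult_left_mono)
  finally show "(\<Sum>i<m. (cmod (ell2_nth ((weighted_shift a ^^ n) x) i))\<^sup>2) \<le> (C * norm x)\<^sup>2" .
qed

lemma onorm_weighted_shift_le:
  assumes "\<And>j. \<bar>a j\<bar> \<le> C"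
  shows "onorm (weighted_shift a) \<le> C"
proof (rule onorm_bound)
  show "0 \<le> C" using assms[of 0] by linarith
  show "norm (weighted_shift a x) \<le> C * norm x" for x
    using norm_weighted_shift_funpow_le[of 1 C x] assms by simp
qed

lemma weight_le_onorm: "\<bar>a j\<bar> \<le> onorm (weighted_shift a)"
  using onorm[OF bounded_opD(1)[OF bounded_op_weighted_shift[OF bdd]], of "unit_ell2 j"]
  by (simp add: weighted_shift_unit[OF bdd] norm_scaleC)

text \<open>If \<open>W - c\<close> is invertible, the orbit of \<open>e\<^sub>j\<close> under \<open>W\<close> can be read off
  the coordinates of \<open>(W - c)\<inverse> e\<^sub>j\<close>, which are bounded uniformly in \<open>j\<close>.\<close>

lemma notin_op_spectrum_weighted_shift_bound:
  assumes "c \<notin> op_spectrum (weighted_shift a)" "c \<noteq> 0"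
  obtains K where "0 < K" "\<And>m j. \<bar>\<Prod>k<m. a (j + k)\<bar> \<le> K * cmod c ^ m"
proof -
  let ?W = "weighted_shift a"
  obtain S where S: "bounded_op S" "(\<lambda>x. ?W x - c *\<^sub>C x) \<circ> S = id"
    using assms(1) unfolding op_spectrum_def by blast
  \<comment> \<open>The extra factor \<open>cmod c\<close> comes from the power
    \<open>c ^ Suc m\<close> in the coordinate formula. Adding 1 to \<open>onorm S\<close> keeps the
    constant strictly positive, so that its logarithm can be taken later.\<close>
  have "\<bar>\<Prod>k<m. a (j + k)\<bar> \<le> (onorm S + 1) * cmod c * cmod c ^ m" for m j
  proof -
    define x where "x = S (unit_ell2 j)"
    have "?W x - c *\<^sub>C x = unit_ell2 j"
      using fun_cong[OF S(2), of "unit_ell2 j"] by (simp add: x_def)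
    hence "ell2_nth (?W x - c *\<^sub>C x) i = ell2_nth (unit_ell2 j) i" for i by simp
    hence eq: "(case i of 0 \<Rightarrow> 0 | Suc k \<Rightarrow> complex_of_real (a k) * ell2_nth x k)
        = c * ell2_nth x i + (if i = j then 1 else 0)" for i
      by (simp add: ell2_nth_weighted_shift[OF bdd] algebra_simps)
    \<comment> \<open>The coordinate equations are a recursion: it forces zeros below
      \<open>j\<close>, the value \<open>- 1 / c\<close> at \<open>j\<close>, and from there on each
      step multiplies by the next weight over \<open>c\<close>.\<close>
    have zero: "i < j \<Longrightarrow> ell2_nth x i = 0" for i
    proof (induction i)
      case 0
      thus ?case using eq[of 0] assms(2) by simp
    next
      case (Suc i)
      thus ?case using eq[of "Suc i"] assms(2) by simp
    qed
    have "c * ell2_nth x j = - 1"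
      using eq[of j] zero[of "j - 1"] by (cases j) (auto simp: eq_neg_iff_add_eq_0)
    moreover have "c * ell2_nth x (Suc (j + m)) = complex_of_real (a (j + m)) * ell2_nth x (j + m)" for m
      using eq[of "Suc (j + m)"] by simp
    ultimately have "c ^ Suc m * ell2_nth x (j + m) = - complex_of_real (\<Prod>k<m. a (j + k))" for m
    proof (induction m)
      case (Suc m)
      have "c ^ Suc (Suc m) * ell2_nth x (j + Suc m)
          = c ^ Suc m * (c * ell2_nth x (Suc (j + m)))" by simp
      also have "\<dots> = complex_of_real (a (j + m)) * (c ^ Suc m * ell2_nth x (j + m))"
        by (simp add: Suc.prems(2))
      also have "c ^ Suc m * ell2_nth x (j + m) = - complex_of_real (\<Prod>k<m. a (j + k))"
        by (rule Suc.IH[OF Suc.prems])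
      finally show ?case by (simp add: mult_ac)
    qed simp
    hence "cmod (c ^ Suc m * ell2_nth x (j + m)) = \<bar>\<Prod>k<m. a (j + k)\<bar>"
      by (simp del: of_real_prod power_Suc)
    moreover have "cmod (ell2_nth x (j + m)) \<le> onorm S + 1"
      using cmod_le_norm_ell2[of x "j + m"] onorm[OF bounded_opD(1)[OF S(1)], of "unit_ell2 j"]
      by (simp add: x_def)
    ultimately show ?thesis
      using mult_left_mono[of "cmod (ell2_nth x (j + m))" "onorm S + 1" "cmod c ^ Suc m"]
      by (simp add: norm_mult norm_power mult_ac)
  qed
  moreover have "0 < (onorm S + 1) * cmod c"
    using onorm_pos_le[OF bounded_opD(1)[OF S(1)]] assms(2) by simp
  ultimately show thesis using that by blast
qed

text \<open>Vectors in the range have zeroth coordinate 0, so \<open>unit_ell2 0\<close> has no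
  preimage. The spectrum is thus nonempty, as estimates of the supremum in
  \<open>spectral_radius\<close> require.\<close>

lemma zero_in_op_spectrum_weighted_shift: "0 \<in> op_spectrum (weighted_shift a)"
proof (rule ccontr)
  assume "0 \<notin> op_spectrum (weighted_shift a)"
  then obtain S where S: "(\<lambda>x. weighted_shift a x - 0 *\<^sub>C x) \<circ> S = id"
    unfolding op_spectrum_def by blast
  have "ell2_nth (weighted_shift a (S (unit_ell2 0)) - 0 *\<^sub>C S (unit_ell2 0)) 0 = 1"
    using fun_cong[OF S, of "unit_ell2 0"] by simp
  thus False by (simp add: ell2_nth_weighted_shift[OF bdd])
qed

end

section \<open>Polar decomposition and mean transform of a weighted shift\<close>

context
  fixes a :: "nat \<Rightarrow> real"
  assumes bdd: "bounded (range a)" and pos: "\<And>i. 0 < a i"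
begin

text \<open>The adjoint shifts indices back and applies each weight a second time, so the product
  under the root is the square of the positive operator \<open>diag_op a\<close>.\<close>

lemma abs_op_weighted_shift: "abs_op (weighted_shift a) = diag_op a"
proof -
  have "weighted_comp Suc a \<circ> weighted_shift a = diag_op a \<circ> diag_op a"
    by (intro ext ell2_eqI) (simp add: ell2_nth_weighted_comp[OF bdd inj_Suc]
        ell2_nth_weighted_comp[OF bdd inj_on_id] ell2_nth_weighted_shift[OF bdd])
  thus ?thesis
    by (simp add: abs_op_def adjoint_op_weighted_shift[OF bdd] sqrt_op_diag_op[OF bdd pos])
qed

text \<open>Positive weights make both null spaces trivial, so the isometry
  \<open>unilateral_shift\<close> qualifies. It is the only choice because \<open>diag_op a\<close>
  scales every basis vector by a nonzero number, so \<open>V \<circ> diag_op a\<close> determines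
  \<open>V\<close> on the basis.\<close>

lemma polar_part_weighted_shift: "polar_part (weighted_shift a) = unilateral_shift"
  unfolding polar_part_def abs_op_weighted_shift
proof (rule the_equality)
  let ?W = "weighted_shift a"
  have bU: "bounded_op unilateral_shift"
    by (rule bounded_op_weighted_shift[OF bounded_range_one])
  have factor: "?W = unilateral_shift \<circ> diag_op a"
    by (intro ext ell2_eqI) (simp add: ell2_nth_weighted_comp[OF bdd inj_on_id]
        ell2_nth_weighted_shift[OF bdd] ell2_nth_unilateral_shift split: nat.split)
  have "x = 0" if "?W x = 0" for x
  proof (rule ell2_eqI)
    fix i
    show "ell2_nth x i = ell2_nth 0 i"
      using arg_cong[OF that, of "\<lambda>y. ell2_nth y (Suc i)"] pos[of i]
      by (simp add: ell2_nth_weighted_shift[OF bdd])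
  qed
  moreover have "?W 0 = 0"
    by (rule linear_0[OF bounded_linear.linear[OF bounded_opD(1)[OF bounded_op_weighted_shift[OF bdd]]]])
  ultimately have "null_space ?W = {0}" by (auto simp: null_space_def)
  moreover have "unilateral_shift x = 0 \<longleftrightarrow> x = 0" for x
    unfolding norm_eq_zero[of "unilateral_shift x", symmetric] norm_unilateral_shift
    by (rule norm_eq_zero)
  hence "null_space unilateral_shift = {0}" by (simp add: null_space_def)
  ultimately show "partial_isometry unilateral_shift \<and> null_space unilateral_shift = null_space ?W
      \<and> ?W = unilateral_shift \<circ> diag_op a"
    using bU factor by (simp add: partial_isometry_def norm_unilateral_shift)
  fix V assume V: "partial_isometry V \<and> null_space V = null_space ?W \<and> ?W = V \<circ> diag_op a"
  hence bV: "bounded_op V" by (simp add: partial_isometry_def)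
  show "V = unilateral_shift"
  proof (rule bounded_op_eqI[OF bV bU])
    fix j
    have "V \<circ> diag_op a = unilateral_shift \<circ> diag_op a" using V factor by argo
    from fun_cong[OF this, of "unit_ell2 j", unfolded o_apply]
    have "complex_of_real (1 / a j) *\<^sub>C complex_of_real (a j) *\<^sub>C V (unit_ell2 j)
        = complex_of_real (1 / a j) *\<^sub>C complex_of_real (a j) *\<^sub>C unilateral_shift (unit_ell2 j)"
      by (simp add: diag_op_unit[OF bdd] bounded_opD(2)[OF bV] bounded_opD(2)[OF bU])
    thus "V (unit_ell2 j) = unilateral_shift (unit_ell2 j)"
      using pos[of j] by (simp add: scaleC_scaleC)
  qed
qed

text \<open>With \<open>U\<close> the unilateral shift and \<open>D = diag_op a\<close>, both
  \<open>U D\<close> and \<open>D U\<close> send \<open>unit_ell2 i\<close> to a multiple of the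
  next basis vector, with factors \<open>a i\<close> and \<open>a (Suc i)\<close>.\<close>

lemma mean_transform_weighted_shift:
  "mean_transform (weighted_shift a) = weighted_shift (\<lambda>i. (a i + a (Suc i)) / 2)"
proof -
  obtain B where B: "\<And>k. \<bar>a k\<bar> \<le> B" using bdd by (auto simp: bounded_iff)
  have "\<bar>(a i + a (Suc i)) / 2\<bar> \<le> B" for i using B[of i] B[of "Suc i"] by (auto simp: abs_le_iff)
  hence bdd': "bounded (range (\<lambda>i. (a i + a (Suc i)) / 2))" by (auto simp: bounded_iff)
  show ?thesis
    unfolding mean_transform_def abs_op_weighted_shift polar_part_weighted_shift
    by (intro ext ell2_eqI) (simp add: ell2_nth_weighted_comp[OF bdd inj_on_id]
        ell2_nth_weighted_shift[OF bdd'] ell2_nth_unilateral_shift algebra_simps split: nat.split)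
qed

end


section \<open>Uniform upper means\<close>

text \<open>By subadditivity this is the limit of \<open>sup\<^sub>j (a\<^sub>j + \<dots> + a\<^bsub>j+n-1\<^esub>) / n\<close>;
  the affine form makes both estimates below immediate.\<close>

definition upper_mean :: "(nat \<Rightarrow> real) \<Rightarrow> real" where
  "upper_mean a = Inf {L. \<exists>C. \<forall>n j. (\<Sum>k<n. a (j + k)) \<le> C + real n * L}"

context
  fixes a :: "nat \<Rightarrow> real"
  assumes bdd: "bounded (range a)" and pos: "\<And>i. 0 < a i"
begin

text \<open>Sums of positive terms cannot stay below a line of negative slope. This bounds the
  defining set below, so its infimum is meaningful.\<close>

lemma upper_mean_set_nonneg:
  assumes "\<And>n j. (\<Sum>k<n. a (j + k)) \<le> C + real n * L"
  shows "0 \<le> L"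
proof (rule ccontr)
  assume "\<not> 0 \<le> L"
  then obtain n where "C < real n * (- L)" using ex_less_of_nat_mult[of "- L" C] by auto
  moreover have "0 \<le> (\<Sum>k<n. a (0 + k))" by (intro sum_nonneg less_imp_le pos)
  ultimately show False using assms[where n = n and j = 0] by linarith
qed

lemma upper_mean_le:
  assumes "\<And>n j. (\<Sum>k<n. a (j + k)) \<le> C + real n * L"
  shows "upper_mean a \<le> L"
  unfolding upper_mean_def
proof (rule cInf_lower)
  show "bdd_below {L. \<exists>C. \<forall>n j. (\<Sum>k<n. a (j + k)) \<le> C + real n * L}"
    using upper_mean_set_nonneg by (intro bdd_belowI[of _ 0]) blast
qed (use assms in blast)

lemma upper_mean_set_nonempty: "{L. \<exists>C. \<forall>n j. (\<Sum>k<n. a (j + k)) \<le> C + real n * L} \<noteq> {}"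
proof -
  obtain B where B: "\<And>k. \<bar>a k\<bar> \<le> B" using bdd by (auto simp: bounded_iff)
  have "(\<Sum>k<n. a (j + k)) \<le> 0 + real n * B" for n j
    using sum_bounded_above[of "{..<n}" "\<lambda>k. a (j + k)" B] B by (simp add: abs_le_iff)
  thus ?thesis by blast
qed

lemma upper_mean_nonneg: "0 \<le> upper_mean a"
  unfolding upper_mean_def
  by (rule cInf_greatest[OF upper_mean_set_nonempty]) (use upper_mean_set_nonneg in blast)

text \<open>The infimum need not be attained, so an affine bound is extracted only for slopes
  strictly above it.\<close>

lemma upper_mean_lessE:
  assumes "upper_mean a < L"
  obtains C where "0 \<le> C" "\<And>n j. (\<Sum>k<n. a (j + k)) \<le> C + real n * L"
proof -
  obtain L' C where L': "L' < L" and C: "\<And>n j. (\<Sum>k<n. a (j + k)) \<le> C + real n * L'"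
    using cInf_lessD[OF upper_mean_set_nonempty] assms unfolding upper_mean_def by blast
  have "(\<Sum>k<n. a (j + k)) \<le> C + real n * L" for n j
    using C[where n = n and j = j] mult_left_mono[of L' L "real n"] L' by simp
  \<comment> \<open>The empty window \<open>n = 0\<close> gives the sign of
    \<open>C\<close>.\<close>
  moreover have "0 \<le> C" using C[where n = 0] by simp
  ultimately show thesis using that by blast
qed

section \<open>Spectral radii in terms of the upper mean\<close>

lemma exp_less_iff_less_ln: "0 < x \<Longrightarrow> exp y < x \<longleftrightarrow> y < ln x" for x :: real
  by (metis exp_less_cancel_iff exp_ln)

text \<open>An affine bound of slope \<open>L < ln (cmod c)\<close> on sums exponentiates to a bound
  on products with ratio \<open>exp L < cmod c\<close>, and the Neumann series then excludes
  \<open>c\<close> from the spectrum.\<close>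

lemma cmod_le_of_in_op_spectrum_exp:
  assumes "c \<in> op_spectrum (weighted_shift (\<lambda>i. exp (a i)))" and "bounded (range (\<lambda>i. exp (a i)))"
  shows "cmod c \<le> exp (upper_mean a)"
proof (rule ccontr)
  assume "\<not> cmod c \<le> exp (upper_mean a)"
  hence c: "exp (upper_mean a) < cmod c" by simp
  hence "0 < cmod c" using exp_gt_zero[of "upper_mean a"] by linarith
  hence "upper_mean a < ln (cmod c)" using c by (simp add: exp_less_iff_less_ln)
  then obtain L where L: "upper_mean a < L" "L < ln (cmod c)" using dense by blast
  obtain C where C: "\<And>n j. (\<Sum>k<n. a (j + k)) \<le> C + real n * L"
    using upper_mean_lessE[OF L(1)] by metis
  have "\<bar>\<Prod>k<n. exp (a (j + k))\<bar> \<le> exp C * exp L ^ n" for n j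
    using C[where n = n and j = j]
    by (simp add: exp_sum[symmetric] exp_add[symmetric] exp_of_nat_mult[symmetric])
  hence "c \<notin> op_spectrum (weighted_shift (\<lambda>i. exp (a i)))"
    using L \<open>0 < cmod c\<close>
    by (intro notin_op_spectrum_of_power_bound[where \<rho> = "exp L" and K = "exp C"]
        bounded_op_weighted_shift norm_weighted_shift_funpow_le assms(2))
      (auto simp: exp_less_iff_less_ln)
  thus False using assms(1) by blast
qed

text \<open>Outside the spectrum, the resolvent would bound all products geometrically with ratio
  \<open>x\<close>; taking logarithms gives an affine bound of slope
  \<open>ln x < upper_mean a\<close>. These points push the supremum up to
  \<open>exp (upper_mean a)\<close>.\<close>

lemma in_op_spectrum_exp:
  assumes "0 < x" "x < exp (upper_mean a)" and "bounded (range (\<lambda>i. exp (a i)))"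
  shows "complex_of_real x \<in> op_spectrum (weighted_shift (\<lambda>i. exp (a i)))"
proof (rule ccontr)
  assume "complex_of_real x \<notin> op_spectrum (weighted_shift (\<lambda>i. exp (a i)))"
  then obtain K where "0 < K"
    and K: "\<And>m j. \<bar>\<Prod>k<m. exp (a (j + k))\<bar> \<le> K * cmod (complex_of_real x) ^ m"
    using notin_op_spectrum_weighted_shift_bound[OF assms(3)] assms(1)
    by (metis of_real_eq_0_iff order_less_irrefl)
  have "(\<Sum>k<m. a (j + k)) \<le> ln K + real m * ln x" for m j
  proof -
    have "exp (\<Sum>k<m. a (j + k)) \<le> K * x ^ m" using K[where m = m and j = j] assms(1) by (simp add: exp_sum)
    hence "(\<Sum>k<m. a (j + k)) \<le> ln (K * x ^ m)" using \<open>0 < K\<close> assms(1) by (simp add: ln_ge_iff)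
    thus ?thesis using \<open>0 < K\<close> assms(1) by (simp add: ln_mult ln_realpow)
  qed
  hence "upper_mean a \<le> ln x" by (rule upper_mean_le)
  thus False using assms by (simp add: ln_ge_iff)
qed

lemma spectral_radius_weighted_shift_exp:
  "spectral_radius (weighted_shift (\<lambda>i. exp (a i))) = exp (upper_mean a)"
  unfolding spectral_radius_def
proof (rule antisym)
  let ?S = "op_spectrum (weighted_shift (\<lambda>i. exp (a i)))"
  obtain B where B: "\<And>k. \<bar>a k\<bar> \<le> B" using bdd by (auto simp: bounded_iff)
  have "\<bar>exp (a i)\<bar> \<le> exp B" for i using B[of i] by (simp add: abs_le_iff)
  hence bdd': "bounded (range (\<lambda>i. exp (a i)))" by (auto simp: bounded_iff)
  note le = cmod_le_of_in_op_spectrum_exp[OF _ bdd']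
  show "(SUP c\<in>?S. cmod c) \<le> exp (upper_mean a)"
    using zero_in_op_spectrum_weighted_shift[OF bdd'] le by (intro cSUP_least) auto
  show "exp (upper_mean a) \<le> (SUP c\<in>?S. cmod c)"
  proof (rule dense_le_bounded[OF exp_gt_zero])
    fix x assume x: "0 < x" "x < exp (upper_mean a)"
    have "cmod (complex_of_real x) \<le> (SUP c\<in>?S. cmod c)"
      using le by (intro cSUP_upper in_op_spectrum_exp x bdd' bdd_aboveI2)
    thus "x \<le> (SUP c\<in>?S. cmod c)" using x by simp
  qed
qed

text \<open>The inequality \<open>t \<le> exp (t - 1)\<close> at \<open>t = a i / L\<close> bounds a
  product of weights by their sum, so the affine bound on sums again feeds the Neumann
  series.\<close>

lemma spectral_radius_weighted_shift_le: "spectral_radius (weighted_shift a) \<le> upper_mean a"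
  unfolding spectral_radius_def
proof (rule cSUP_least)
  fix c assume c: "c \<in> op_spectrum (weighted_shift a)"
  show "cmod c \<le> upper_mean a"
  proof (rule ccontr)
    assume "\<not> cmod c \<le> upper_mean a"
    then obtain L where L: "upper_mean a < L" "L < cmod c" using dense[of "upper_mean a" "cmod c"] by auto
    have "0 < L" using upper_mean_nonneg L(1) by linarith
    obtain C where C: "\<And>n j. (\<Sum>k<n. a (j + k)) \<le> C + real n * L"
      using upper_mean_lessE[OF L(1)] by metis
    have "\<bar>\<Prod>k<n. a (j + k)\<bar> \<le> exp (C / L) * L ^ n" for n j
    proof -
      have "\<bar>\<Prod>k<n. a (j + k)\<bar> = (\<Prod>k<n. a (j + k))"
        by (intro abs_of_nonneg prod_nonneg less_imp_le pos)
      also have "\<dots> \<le> (\<Prod>k<n. L * exp (a (j + k) / L - 1))"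
      proof (rule prod_mono)
        fix k
        show "0 \<le> a (j + k) \<and> a (j + k) \<le> L * exp (a (j + k) / L - 1)"
          using exp_ge_add_one_self[of "a (j + k) / L - 1"] \<open>0 < L\<close> pos[of "j + k"]
          by (simp add: field_simps less_imp_le)
      qed
      also have "\<dots> = L ^ n * exp ((\<Sum>k<n. a (j + k)) / L - n)"
        by (simp add: prod.distrib exp_sum[symmetric] sum_subtractf sum_divide_distrib)
      \<comment> \<open>Dividing \<open>C + n L\<close> by \<open>L\<close> produces an
        \<open>n\<close> that cancels the \<open>- n\<close> in the exponent, leaving a
        constant.\<close>
      also have "\<dots> \<le> L ^ n * exp (C / L)"
        using divide_right_mono[OF C[where n = n and j = j], of L] \<open>0 < L\<close>
        by (intro mult_left_mono) (simp_all add: add_divide_distrib)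
      finally show ?thesis by (simp add: mult.commute)
    qed
    hence "c \<notin> op_spectrum (weighted_shift a)"
      using L \<open>0 < L\<close>
      by (intro notin_op_spectrum_of_power_bound[where \<rho> = L and K = "exp (C / L)"]
          bounded_op_weighted_shift norm_weighted_shift_funpow_le bdd) auto
    thus False using c by blast
  qed
qed (use zero_in_op_spectrum_weighted_shift[OF bdd] in blast)

end


section \<open>Iterated averages\<close>

definition avg :: "(nat \<Rightarrow> real) \<Rightarrow> nat \<Rightarrow> real" where
  "avg a i = (a i + a (Suc i)) / 2"

lemma avg_funpow_Suc: "(avg ^^ Suc n) a i = ((avg ^^ n) a i + (avg ^^ n) a (Suc i)) / 2"
  by (simp add: avg_def)

lemma avg_funpow_le: "(\<And>i. a i \<le> c) \<Longrightarrow> (avg ^^ n) a i \<le> c"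
proof (induction n arbitrary: i)
  case (Suc n)
  show ?case using Suc.IH[of i] Suc.IH[of "Suc i"] Suc.prems by (simp add: avg_def)
qed simp

lemma avg_funpow_pos: "(\<And>i. 0 < a i) \<Longrightarrow> 0 < (avg ^^ n) a i"
proof (induction n arbitrary: i)
  case (Suc n)
  show ?case using Suc.IH[of i] Suc.IH[of "Suc i"] Suc.prems by (simp add: avg_def)
qed simp

lemma bounded_avg_funpow:
  assumes "bounded (range a)" "\<And>i. 0 < a i"
  shows "bounded (range ((avg ^^ n) a))"
proof -
  obtain B where "\<And>k. \<bar>a k\<bar> \<le> B" using assms(1) by (auto simp: bounded_iff)
  hence "(avg ^^ n) a i \<le> B" for i by (intro avg_funpow_le) (simp add: abs_le_iff)
  hence "\<bar>(avg ^^ n) a i\<bar> \<le> B" for i using avg_funpow_pos[of a n i, OF assms(2)] by simp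
  thus ?thesis by (auto simp: bounded_iff)
qed

lemma mean_transform_funpow_weighted_shift:
  assumes "bounded (range a)" "\<And>i. 0 < a i"
  shows "(mean_transform ^^ n) (weighted_shift a) = weighted_shift ((avg ^^ n) a)"
proof (induction n)
  case (Suc n)
  thus ?case
    using mean_transform_weighted_shift[OF bounded_avg_funpow[of a, OF assms] avg_funpow_pos[of a, OF assms(2)]]
    by (simp add: avg_def[abs_def])
qed simp

text \<open>Averages and window sums are both combinations of translates, hence commute; a uniform
  bound on window sums of \<open>a\<close> therefore passes to its iterated averages.\<close>

lemma sum_avg_funpow:
  "(\<Sum>k<N. (avg ^^ n) a (j + k)) = (avg ^^ n) (\<lambda>j. \<Sum>k<N. a (j + k)) j"
proof (induction n arbitrary: j)
  case (Suc n)
  have "(\<Sum>k<N. (avg ^^ Suc n) a (j + k))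
      = ((\<Sum>k<N. (avg ^^ n) a (j + k)) + (\<Sum>k<N. (avg ^^ n) a (Suc j + k))) / 2"
    unfolding avg_funpow_Suc by (simp add: sum.distrib sum_divide_distrib[symmetric])
  thus ?case unfolding Suc.IH avg_funpow_Suc .
qed simp

text \<open>By telescoping, averaging changes a window sum only by
  \<open>(a (j + N) - a j) / 2\<close>, a boundary term bounded independently of
  \<open>N\<close>.\<close>

lemma sum_le_sum_avg:
  assumes "\<And>i. 0 \<le> a i" "\<And>i. a i \<le> B"
  shows "(\<Sum>k<N. a (j + k)) \<le> (\<Sum>k<N. avg a (j + k)) + B"
proof -
  have "(\<Sum>k<N. a (j + Suc k)) - (\<Sum>k<N. a (j + k)) = a (j + N) - a j"
    using sum_lessThan_telescope[of "\<lambda>k. a (j + k)" N] by (simp add: sum_subtractf)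
  moreover have "2 * (\<Sum>k<N. avg a (j + k)) = (\<Sum>k<N. a (j + k)) + (\<Sum>k<N. a (j + Suc k))"
    by (simp add: avg_def sum_divide_distrib[symmetric] sum.distrib)
  ultimately show ?thesis
    using assms(1)[of "j + N"] assms(2)[of j] assms(1)[of j] by linarith
qed

text \<open>Undoing \<open>n\<close> averagings costs at most \<open>n * B\<close>, whatever the
  window length, so the loss is absorbed by the additive constant in
  \<open>upper_mean\<close>.\<close>

lemma upper_mean_le_of_avg_funpow_le:
  assumes "bounded (range a)" "\<And>i. 0 < a i" "\<And>i. (avg ^^ n) a i \<le> c"
  shows "upper_mean a \<le> c"
proof -
  obtain B where "\<And>k. \<bar>a k\<bar> \<le> B" using assms(1) by (auto simp: bounded_iff)
  hence B: "a k \<le> B" for k by (simp add: abs_le_iff)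
  have shift: "(\<Sum>k<N. a (j + k)) \<le> (\<Sum>k<N. (avg ^^ n) a (j + k)) + real n * B" for N j n
  proof (induction n)
    case (Suc n)
    have "(\<Sum>k<N. (avg ^^ n) a (j + k)) \<le> (\<Sum>k<N. avg ((avg ^^ n) a) (j + k)) + B"
      using avg_funpow_pos[of a, OF assms(2)] avg_funpow_le[of a, OF B]
      by (intro sum_le_sum_avg) (auto intro: less_imp_le)
    thus ?case using Suc.IH by (simp add: algebra_simps)
  qed simp
  have "(\<Sum>k<N. a (j + k)) \<le> real n * B + real N * c" for N j
    using shift[where N = N and j = j and n = n]
      sum_bounded_above[of "{..<N}" "\<lambda>k. (avg ^^ n) a (j + k)" c] assms(3) by simp
  thus ?thesis by (rule upper_mean_le[OF assms(1,2)])
qed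

section \<open>Binomial weights and near invariance under translation\<close>

text \<open>Pascal's rule in summed form; the arbitrary \<open>b\<close> lets it drive the
  inductions for both the averages and the second moment.\<close>

lemma sum_binomial_Suc:
  fixes b :: "nat \<Rightarrow> real"
  shows "(\<Sum>k\<le>Suc n. real (Suc n choose k) * b k)
    = (\<Sum>k\<le>n. real (n choose k) * (b k + b (Suc k)))"
proof -
  have "(\<Sum>k\<le>Suc n. real (Suc n choose k) * b k)
      = b 0 + (\<Sum>k\<le>n. real (n choose Suc k) * b (Suc k)) + (\<Sum>k\<le>n. real (n choose k) * b (Suc k))"
    by (simp add: sum.atMost_Suc_shift algebra_simps sum.distrib del: sum.atMost_Suc)
  also have "b 0 + (\<Sum>k\<le>n. real (n choose Suc k) * b (Suc k))
      = (\<Sum>k\<le>Suc n. real (n choose k) * b k)"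
    by (simp add: sum.atMost_Suc_shift del: sum.atMost_Suc)
  also have "\<dots> = (\<Sum>k\<le>n. real (n choose k) * b k)" by simp
  finally show ?thesis by (simp add: sum.distrib algebra_simps)
qed

lemma avg_funpow_binomial:
  "2 ^ n * (avg ^^ n) a i = (\<Sum>k\<le>n. real (n choose k) * a (i + k))"
proof (induction n arbitrary: i)
  case (Suc n)
  have "2 ^ Suc n * (avg ^^ Suc n) a i = 2 ^ n * (avg ^^ n) a i + 2 ^ n * (avg ^^ n) a (Suc i)"
    by (simp add: avg_def algebra_simps)
  thus ?case unfolding sum_binomial_Suc Suc.IH by (simp add: sum.distrib algebra_simps)
qed simp

text \<open>This is the variance \<open>n\<close> of a sum of \<open>n\<close> independent fair
  signs, scaled by \<open>2 ^ n\<close>. The induction rests on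
  \<open>(x + 1)^2 + (x - 1)^2 = 2 x^2 + 2\<close>.\<close>

lemma sum_binomial_centered_square:
  "(\<Sum>k\<le>n. real (n choose k) * (real n - 2 * real k)\<^sup>2) = real n * 2 ^ n"
proof (induction n)
  case (Suc n)
  have "(\<Sum>k\<le>Suc n. real (Suc n choose k) * (real (Suc n) - 2 * real k)\<^sup>2)
      = 2 * (\<Sum>k\<le>n. real (n choose k) * (real n - 2 * real k)\<^sup>2) + 2 * (\<Sum>k\<le>n. real (n choose k))"
    unfolding sum_binomial_Suc
    unfolding sum_distrib_left sum.distrib[symmetric]
    by (rule sum.cong) (simp_all add: power2_eq_square algebra_simps)
  also have "(\<Sum>k\<le>n. real (n choose k)) = 2 ^ n"
    using arg_cong[OF choose_row_sum[of n], of real] by simp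
  finally show ?case using Suc by (simp add: algebra_simps)
qed simp

text \<open>Consecutive binomial coefficients satisfy
  \<open>(n + 1) (C(n,k) - C(n,k-1)) = (n + 1 - 2 k) C(n+1,k)\<close>, so a difference of translates
  becomes a sum against a centered kernel.\<close>

lemma avg_funpow_diff:
  "real (Suc n) * 2 ^ n * ((avg ^^ n) a i - (avg ^^ n) a (Suc i))
    = (\<Sum>k\<le>Suc n. real (Suc n choose k) * (real (Suc n) - 2 * real k) * a (i + k))"
proof -
  have "(\<Sum>k\<le>Suc n. real (Suc n choose k) * (real (Suc n) - 2 * real k) * a (i + k))
      = (\<Sum>k\<le>Suc n. (real (Suc n) - real k) * real (Suc n choose k) * a (i + k))
      - (\<Sum>k\<le>Suc n. real k * real (Suc n choose k) * a (i + k))"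
    by (simp only: sum_subtractf[symmetric]) (rule sum.cong, simp, simp add: algebra_simps)
  \<comment> \<open>The factor kills the top term \<open>k = Suc n\<close> here; in the other sum
    the factor \<open>k\<close> kills the bottom term, which allows the index shift.\<close>
  also have "(\<Sum>k\<le>Suc n. (real (Suc n) - real k) * real (Suc n choose k) * a (i + k))
      = (\<Sum>k\<le>n. (real (Suc n) - real k) * real (Suc n choose k) * a (i + k))" by simp
  also have "\<dots> = real (Suc n) * (\<Sum>k\<le>n. real (n choose k) * a (i + k))"
    unfolding sum_distrib_left
  proof (rule sum.cong)
    fix k assume k: "k \<in> {..n}"
    have "(real (Suc n) - real k) * real (Suc n choose k) = real (Suc n) * real (n choose k)"
    proof -
      have "real (Suc n - k) * real (Suc n choose k) = real (Suc n) * real (n choose k)"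
        unfolding of_nat_mult[symmetric] binomial_absorb_comp by simp
      thus ?thesis using k by (simp only: of_nat_diff atMost_iff le_SucI)
    qed
    thus "(real (Suc n) - real k) * real (Suc n choose k) * a (i + k)
        = real (Suc n) * (real (n choose k) * a (i + k))" by simp
  qed simp
  also have "(\<Sum>k\<le>Suc n. real k * real (Suc n choose k) * a (i + k))
      = (\<Sum>k\<le>n. real (Suc k * (Suc n choose Suc k)) * a (Suc i + k))"
    by (simp add: sum.atMost_Suc_shift distrib_right del: sum.atMost_Suc binomial_Suc_Suc)
  also have "\<dots> = real (Suc n) * (\<Sum>k\<le>n. real (n choose k) * a (Suc i + k))"
    unfolding Suc_times_binomial sum_distrib_left of_nat_mult by (simp add: mult.assoc)
  finally show ?thesis
    by (simp only: avg_funpow_binomial[symmetric]) (simp add: algebra_simps)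
qed

text \<open>The bound is \<open>\<bar>x\<bar> \<le> (s + x\<^sup>2 / s) / 2\<close> with \<open>s\<close> the standard deviation.\<close>

lemma avg_funpow_diff_le:
  assumes "\<And>i. \<bar>a i\<bar> \<le> B"
  shows "(avg ^^ n) a i - (avg ^^ n) a (Suc i) \<le> 2 * B / sqrt (real (Suc n))"
proof -
  define s where "s = sqrt (real (Suc n))"
  have s: "0 < s" "s * s = real (Suc n)" by (simp_all add: s_def)
  have B: "0 \<le> B" using assms[of 0] by linarith
  have "s * s * 2 ^ n * ((avg ^^ n) a i - (avg ^^ n) a (Suc i))
      = (\<Sum>k\<le>Suc n. real (Suc n choose k) * ((real (Suc n) - 2 * real k) * a (i + k)))"
    unfolding s(2) avg_funpow_diff by (simp only: mult.assoc)
  also have "\<dots> \<le> (\<Sum>k\<le>Suc n. real (Suc n choose k) * ((s + (real (Suc n) - 2 * real k)\<^sup>2 / s) / 2 * B))"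
  proof (intro sum_mono mult_left_mono)
    fix k
    define x where "x = real (Suc n) - 2 * real k"
    have "0 \<le> (s - \<bar>x\<bar>)\<^sup>2" by simp
    hence "\<bar>x\<bar> * s * 2 \<le> s * s + x\<^sup>2" by (simp add: power2_eq_square algebra_simps)
    hence "\<bar>x\<bar> \<le> (s + x\<^sup>2 / s) / 2" using s(1) by (simp add: field_simps)
    hence "\<bar>x\<bar> * \<bar>a (i + k)\<bar> \<le> (s + x\<^sup>2 / s) / 2 * B"
      by (intro mult_mono assms) (use s(1) in auto)
    thus "x * a (i + k) \<le> (s + x\<^sup>2 / s) / 2 * B"
      by (metis abs_le_D1 abs_mult)
  qed simp
  also have "\<dots> = B / 2 * (s * (\<Sum>k\<le>Suc n. real (Suc n choose k))
      + (\<Sum>k\<le>Suc n. real (Suc n choose k) * (real (Suc n) - 2 * real k)\<^sup>2) / s)"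
    unfolding sum_distrib_left sum_divide_distrib sum.distrib[symmetric]
    by (rule sum.cong) (simp_all add: field_simps del: binomial_Suc_Suc)
  also have "(\<Sum>k\<le>Suc n. real (Suc n choose k)) = 2 ^ Suc n"
    using arg_cong[OF choose_row_sum[of "Suc n"], of real] by (simp del: sum.atMost_Suc)
  \<comment> \<open>The second moment is \<open>s * s * 2 ^ Suc n\<close>, so both summands in the
    bracket equal \<open>s * 2 ^ Suc n\<close>.\<close>
  also have "B / 2 * (s * 2 ^ Suc n
      + (\<Sum>k\<le>Suc n. real (Suc n choose k) * (real (Suc n) - 2 * real k)\<^sup>2) / s)
      = s * s * 2 ^ n * (2 * B / s)"
    unfolding sum_binomial_centered_square unfolding s(2)[symmetric] using s(1) by (simp add: field_simps)
  finally show ?thesis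
    unfolding s_def[symmetric] using s(1) by (simp add: pos_le_divide_eq mult.commute)
qed

text \<open>Near invariance replaces the value at \<open>i\<close> by any of the \<open>N\<close>
  values from \<open>i\<close> on, at a cost of at most \<open>N\<close> translation steps. The mean
  over that window is an iterated average of window sums divided by \<open>N\<close>, hence at most
  \<open>L + C / N\<close>.\<close>

lemma avg_funpow_le_of_sum_le:
  assumes "\<And>i. \<bar>a i\<bar> \<le> B" "\<And>j. (\<Sum>k<N. a (j + k)) \<le> C + real N * L" "0 < N"
  shows "(avg ^^ n) a i \<le> L + C / real N + real N * (2 * B / sqrt (real (Suc n)))"
proof -
  let ?d = "2 * B / sqrt (real (Suc n))"
  have "0 \<le> B" using assms(1)[of 0] by linarith
  hence d: "0 \<le> ?d" by simp
  have step: "(avg ^^ n) a i \<le> (avg ^^ n) a (i + k) + real k * ?d" for k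
  proof (induction k)
    case (Suc k)
    thus ?case
      using avg_funpow_diff_le[of a B n "i + k", OF assms(1)]
      by (simp add: distrib_right del: of_nat_Suc) (simp add: distrib_right add_divide_distrib)
  qed simp
  have "real N * (avg ^^ n) a i \<le> (\<Sum>k<N. (avg ^^ n) a (i + k) + real N * ?d)"
  proof -
    have "(avg ^^ n) a i \<le> (avg ^^ n) a (i + k) + real N * ?d" if "k < N" for k
      using step[of k] mult_right_mono[OF _ d, of "real k" "real N"] that by linarith
    hence "(\<Sum>k<N. (avg ^^ n) a i) \<le> (\<Sum>k<N. (avg ^^ n) a (i + k) + real N * ?d)"
      by (intro sum_mono) auto
    thus ?thesis by simp
  qed
  also have "\<dots> = (\<Sum>k<N. (avg ^^ n) a (i + k)) + real N * (real N * ?d)"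
    by (simp add: sum.distrib)
  also have "\<dots> \<le> C + real N * L + real N * (real N * ?d)"
    unfolding sum_avg_funpow using avg_funpow_le[OF assms(2)] by simp
  also have "\<dots> = real N * (L + C / real N + real N * ?d)"
    using assms(3) by (simp add: distrib_left)
  finally show ?thesis using assms(3) by simp
qed

section \<open>The mean limit\<close>

lemma mean_limit_weighted_shift:
  assumes bdd: "bounded (range a)" and pos: "\<And>i. 0 < a i"
  shows "mean_limit (weighted_shift a) = upper_mean a"
proof -
  let ?f = "\<lambda>n. onorm (weighted_shift ((avg ^^ n) a))"
  note bddn = bounded_avg_funpow[of a, OF bdd pos]
  obtain B where B: "\<And>k. \<bar>a k\<bar> \<le> B" using bdd by (auto simp: bounded_iff)
  have lower: "upper_mean a \<le> ?f n" for n
    using weight_le_onorm[OF bddn]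
    by (intro upper_mean_le_of_avg_funpow_le[OF bdd pos]) (rule abs_le_D1)
  have "?f \<longlonglongrightarrow> upper_mean a"
  proof (rule order_tendstoI)
    fix u assume "upper_mean a < u"
    then obtain L where L: "upper_mean a < L" "L < u" using dense by blast
    obtain C where C: "0 \<le> C" "\<And>n j. (\<Sum>k<n. a (j + k)) \<le> C + real n * L"
      using upper_mean_lessE[OF bdd pos L(1)] by metis
    \<comment> \<open>Half of the gap pays for \<open>C / N\<close>, which fixes \<open>N\<close>;
      the other half pays for the translation error, which vanishes as \<open>n\<close> grows with
      \<open>N\<close> fixed.\<close>
    define e where "e = (u - L) / 2"
    have e: "0 < e" "u = L + 2 * e" using L(2) by (simp_all add: e_def field_simps)
    obtain N where N: "C / e < real N" using reals_Archimedean2 by blast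
    moreover have "0 \<le> C / e" using C(1) e(1) by simp
    ultimately have "0 < real N" by linarith
    have CN: "C / real N < e"
      using N \<open>0 < real N\<close> e(1) by (simp add: field_simps)
    have "(\<lambda>n. real N * (2 * B / sqrt (real (Suc n)))) \<longlonglongrightarrow> 0"
      by real_asymp
    hence "\<forall>\<^sub>F n in sequentially. real N * (2 * B / sqrt (real (Suc n))) < e"
      using e(1) by (rule order_tendstoD)
    thus "\<forall>\<^sub>F n in sequentially. ?f n < u"
    proof eventually_elim
      case (elim n)
      have "\<bar>(avg ^^ n) a i\<bar> \<le> L + C / real N + real N * (2 * B / sqrt (real (Suc n)))" for i
        using avg_funpow_le_of_sum_le[OF B C(2), of N n i] avg_funpow_pos[of a n i, OF pos] \<open>0 < real N\<close>
        by simp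
      hence "?f n \<le> L + C / real N + real N * (2 * B / sqrt (real (Suc n)))"
        by (rule onorm_weighted_shift_le[OF bddn])
      thus ?case using elim CN e(2) by linarith
    qed
  qed (use lower in \<open>auto intro: less_le_trans always_eventually\<close>)
  thus ?thesis
    by (simp add: mean_limit_def mean_transform_funpow_weighted_shift[OF bdd pos] limI)
qed

text \<open>All quantities are compared through \<open>upper_mean \<alpha>\<close>, which is both
  the mean limit and the logarithm of the spectral radius for \<open>\<beta>\<close>.\<close>

theorem theorem4p4:
  fixes \<alpha> \<beta> :: "nat \<Rightarrow> real"
  assumes "bounded (range \<alpha>)"
    and "\<And>i. 0 < \<alpha> i"
    and "\<beta> = (\<lambda>i. exp (\<alpha> i))"
  shows "spectral_radius (weighted_shift \<alpha>) \<le> ln (spectral_radius (weighted_shift \<beta>))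
    \<and> ln (spectral_radius (weighted_shift \<beta>)) = mean_limit (weighted_shift \<alpha>)"
  using spectral_radius_weighted_shift_le[of \<alpha>, OF assms(1,2)]
  unfolding assms(3) mean_limit_weighted_shift[of \<alpha>, OF assms(1,2)]
    spectral_radius_weighted_shift_exp[of \<alpha>, OF assms(1,2)]
  by simp

end
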